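(* Let $G = F(a,b) \times F(c,d)$ be the direct product of two free groups of rank $2$, with free bases $\{a,b\}$ and $\{c,d\}$ respectively. Then the Cayley graph $\mathrm{Cay}(G,A)$ is strongly shortcut when $A = \{a,b,c,d\}$, but $\mathrm{Cay}(G,A)$ is not strongly shortcut when $A = \{a,b,c,db^{-1}\}$.
   Context: $\mathrm{Cay}(G,A)$ is regarded as a metric graph with edges of length $1$. Strongly shortcut: Let $\rho:[0,1]\to X$ with $\rho(0)=\rho(1)$ be a loop in a metric space $X$. A path $\mu$ in $X$ from $\rho(p)$ to $\rho(q)$, where $0\le p\le q\le 1$, subdivides $\rho$ into two loops: $\rho_1$, the concatenation of the reverse of $\rho|_{[p,q]}$ with $\mu$, and $\rho_2$, the concatenation of $\rho|_{[q,1]\cup[0,p]}$ with $\mu$. The space $X$ is strongly shortcut when there exist $L\ge 0$ and $\lambda<1$ such that every loop $\rho$ in $X$ of length $\ell\ge L$ can be subdivided in this way into two loops $\rho_1$ and $\rho_2$, each of length at most $\lambda\ell$. If $X$ is a graph, it is equivalent to require this only for combinatorial loops (closed edge-paths) $\rho$, subdivided into two combinatorial loops. For a Cayley graph $\mathrm{Cay}(G,A)$ with $A$ a finite generating set, the property amounts to the following. A word on $A$ is a string $w=a_1^{\varepsilon_1}\cdots a_n^{\varepsilon_n}$ with $a_i\in A$, $\varepsilon_i\in\{\pm1\}$, and $|w|=n$; its cyclic conjugates are the words $a_{i+1}^{\varepsilon_{i+1}}\cdots a_n^{\varepsilon_n}a_1^{\varepsilon_1}\cdots a_i^{\varepsilon_i}$.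 Then $\mathrm{Cay}(G,A)$ is strongly shortcut if and only if there exist $L>0$ and $\lambda<1$ such that if $w$ is a word on $A$ that represents the identity of $G$ and $|w|\ge L$, then $w$ has a cyclic conjugate expressible as a concatenation $w_1w_2$ of words such that $(1-\lambda)|w|\le|w_1|\le|w_2|$ and for which there exists a word $\mu$ on $A$ that equals $w_1$ in $G$ and satisfies $|\mu|\le\lambda|w_1|$. *)

theory Defs
  imports
    "HOL-Analysis.Abstract_Metric_Spaces"
    "HOL-Library.Extended_Real"
    "HOL-Algebra.Group"
    "HOL-Algebra.Generated_Groups"
    "Graph_Theory.Digraph"
begin

section \<open>Strongly shortcut metric spaces\<close>

context Metric_space
begin

text \<open>
  Length of the restriction of a path \<open>g\<close> to \<open>[p, q]\<close>: the supremum of the lengths of its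
  inscribed polygons \<open>g (t 0), \<dots>, g (t n)\<close> with \<open>p \<le> t 0 \<le> \<dots> \<le> t n \<le> q\<close>.
\<close>

definition path_length :: "(real \<Rightarrow> 'a) \<Rightarrow> real \<Rightarrow> real \<Rightarrow> ereal" where
  "path_length g p q =
     (SUP (n, t) \<in> {(n, t). mono_on {..n} t \<and> t ` {..n} \<subseteq> {p..q}}.
        ereal (\<Sum>i<n. d (g (t i)) (g (t (Suc i)))))"

definition loop_in :: "(real \<Rightarrow> 'a) \<Rightarrow> bool" where
  "loop_in \<rho> \<longleftrightarrow> pathin mtopology \<rho> \<and> \<rho> 0 = \<rho> 1"

text \<open>
  The last two conjuncts bound the lengths of the two loops into which \<open>\<mu>\<close> subdivides \<open>\<rho>\<close>,
  namely \<open>\<rho>\<close> restricted to \<open>[p, q]\<close> (reversed) followed by \<open>\<mu>\<close>, and \<open>\<rho>\<close> restricted to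
  \<open>[q, 1] \<union> [0, p]\<close> followed by \<open>\<mu>\<close>; the length of a concatenation is the sum of the lengths
  of its parts. Loops of infinite length impose no condition.
\<close>

definition strongly_shortcut :: bool where
  "strongly_shortcut \<longleftrightarrow>
     (\<exists>(L::real) \<ge> 0. \<exists>(\<kappa>::real) < 1.
        \<forall>\<rho>. loop_in \<rho> \<and> ereal L \<le> path_length \<rho> 0 1 \<and> path_length \<rho> 0 1 < \<infinity> \<longrightarrow>
          (\<exists>p q \<mu>. 0 \<le> p \<and> p \<le> q \<and> q \<le> 1 \<and>
             pathin mtopology \<mu> \<and> \<mu> 0 = \<rho> p \<and> \<mu> 1 = \<rho> q \<and>
             path_length \<rho> p q + path_length \<mu> 0 1
               \<le> ereal \<kappa> * path_length \<rho> 0 1 \<and>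
             path_length \<rho> q 1 + path_length \<rho> 0 p + path_length \<mu> 0 1
               \<le> ereal \<kappa> * path_length \<rho> 0 1))"

end

section \<open>Graphs as metric spaces\<close>

text \<open>
  The geometric realization of a graph has, besides the vertices, for each edge \<open>e\<close> the points
  \<open>Interior e t\<close> with \<open>0 < t < 1\<close>, at distance \<open>t\<close> along \<open>e\<close> from its tail. The orientation of
  edges serves only as such a parametrization and is ignored by the metric.
\<close>

datatype ('v, 'e) graph_point = Vertex 'v | Interior 'e real

definition graph_points :: "('v, 'e) pre_digraph \<Rightarrow> ('v, 'e) graph_point set" where
  "graph_points H =
     Vertex ` verts H \<union> {Interior e t | e t. e \<in> arcs H \<and> 0 < t \<and> t < 1}"

abbreviation adjacency :: "('v, 'e) pre_digraph \<Rightarrow> ('v \<times> 'v) set" where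
  "adjacency H \<equiv> arcs_ends H \<union> (arcs_ends H)\<inverse>"

text \<open>The least number of edges on an edge-path; meaningful for connected graphs.\<close>

definition vertex_dist :: "('v, 'e) pre_digraph \<Rightarrow> 'v \<Rightarrow> 'v \<Rightarrow> nat" where
  "vertex_dist H u v = (LEAST n. (u, v) \<in> adjacency H ^^ n)"

fun exits :: "('v, 'e) pre_digraph \<Rightarrow> ('v, 'e) graph_point \<Rightarrow> ('v \<times> real) set" where
  "exits H (Vertex v) = {(v, 0)}"
| "exits H (Interior e t) = {(tail H e, t), (head H e, 1 - t)}"

fun direct_lengths :: "('v, 'e) graph_point \<Rightarrow> ('v, 'e) graph_point \<Rightarrow> real set" where
  "direct_lengths (Interior e s) (Interior f t) = (if e = f then {\<bar>s - t\<bar>} else {})"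
| "direct_lengths _ _ = {}"

text \<open>
  The path metric for edges of length 1. A shortest path between two points either stays in the
  interior of a common edge, or leaves the first point through a vertex \<open>u\<close> and arrives at the
  second one through a vertex \<open>v\<close>. The value off the realization is a dummy.
\<close>

definition graph_dist ::
    "('v, 'e) pre_digraph \<Rightarrow> ('v, 'e) graph_point \<Rightarrow> ('v, 'e) graph_point \<Rightarrow> real" where
  "graph_dist H x y =
     (if x \<in> graph_points H \<and> y \<in> graph_points H then
        Min ((\<lambda>((u, s), (v, t)). s + real (vertex_dist H u v) + t) ` (exits H x \<times> exits H y)
             \<union> direct_lengths x y)
      else 0)"

definition strongly_shortcut_graph :: "('v, 'e) pre_digraph \<Rightarrow> bool" where
  "strongly_shortcut_graph H \<longleftrightarrow>
     Metric_space.strongly_shortcut (graph_points H) (graph_dist H)"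

lemma vertex_dist_commute: "vertex_dist H u v = vertex_dist H v u"
proof -
  have "(adjacency H ^^ n)\<inverse> = adjacency H ^^ n" for n
  proof (induction n)
    case (Suc n)
    have "(adjacency H ^^ Suc n)\<inverse> = (adjacency H)\<inverse> O (adjacency H ^^ n)\<inverse>"
      by (simp only: relpow.simps converse_relcomp)
    also have "\<dots> = adjacency H O adjacency H ^^ n"
      by (simp only: Suc converse_Un converse_converse Un_commute)
    also have "\<dots> = adjacency H ^^ Suc n"
      by (simp only: relpow.simps relpow_commute)
    finally show ?case .
  qed simp
  then show ?thesis
    unfolding vertex_dist_def by (metis converse_iff)
qed

lemma vertex_dist_self [simp]: "vertex_dist H u u = 0"
  unfolding vertex_dist_def by (rule Least_eq_0) simp

lemma vertex_dist_le: "(u, v) \<in> adjacency H ^^ n \<Longrightarrow> vertex_dist H u v \<le> n"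
  unfolding vertex_dist_def by (rule Least_le)

lemma relpow_vertex_dist:
  assumes "(u, v) \<in> (adjacency H)\<^sup>*"
  shows "(u, v) \<in> adjacency H ^^ vertex_dist H u v"
  unfolding vertex_dist_def using rtrancl_imp_relpow[OF assms] by (auto intro: LeastI)

lemma vertex_dist_eq_0:
  assumes "(u, v) \<in> (adjacency H)\<^sup>*"
  shows "vertex_dist H u v = 0 \<longleftrightarrow> u = v"
  using relpow_vertex_dist[OF assms] by (auto split: if_splits)

lemma vertex_dist_triangle:
  assumes "(u, v) \<in> (adjacency H)\<^sup>*" "(v, w) \<in> (adjacency H)\<^sup>*"
  shows "vertex_dist H u w \<le> vertex_dist H u v + vertex_dist H v w"
  by (rule vertex_dist_le) (use assms in \<open>auto simp: relpow_add intro: relpow_vertex_dist\<close>)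

lemma vertex_dist_arc:
  assumes "e \<in> arcs H"
  shows "vertex_dist H (tail H e) (head H e) \<le> 1"
  by (rule vertex_dist_le) (use assms in \<open>auto simp: arcs_ends_conv\<close>)

lemma finite_exits [simp]: "finite (exits H x)"
  by (cases x) auto

lemma finite_direct_lengths [simp]: "finite (direct_lengths x y)"
  by (cases x; cases y) auto

lemma exits_nonneg: "x \<in> graph_points H \<Longrightarrow> (u, s) \<in> exits H x \<Longrightarrow> 0 \<le> s"
  by (auto simp: graph_points_def)

lemma exits_nonempty [simp]: "exits H x \<noteq> {}"
  by (cases x) auto

lemma direct_lengths_commute: "direct_lengths x y = direct_lengths y x"
  by (cases x; cases y) (auto simp: abs_minus_commute)

lemma graph_dist_le_route:
  assumes "x \<in> graph_points H" "y \<in> graph_points H" "(u, s) \<in> exits H x" "(v, t) \<in> exits H y"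
  shows "graph_dist H x y \<le> s + real (vertex_dist H u v) + t"
  unfolding graph_dist_def using assms by (auto intro!: Min_le intro: rev_image_eqI)

lemma graph_dist_le_direct:
  assumes "x \<in> graph_points H" "y \<in> graph_points H" "r \<in> direct_lengths x y"
  shows "graph_dist H x y \<le> r"
  unfolding graph_dist_def using assms by (auto intro!: Min_le)

lemma graph_dist_cases:
  assumes "x \<in> graph_points H" "y \<in> graph_points H"
  obtains (route) u s v t where "(u, s) \<in> exits H x" "(v, t) \<in> exits H y"
      "graph_dist H x y = s + real (vertex_dist H u v) + t"
    | (direct) e s t where "x = Interior e s" "y = Interior e t" "graph_dist H x y = \<bar>s - t\<bar>"
proof -
  let ?S = "(\<lambda>((u, s), (v, t)). s + real (vertex_dist H u v) + t) ` (exits H x \<times> exits H y)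
             \<union> direct_lengths x y"
  have "graph_dist H x y = Min ?S"
    using assms by (simp add: graph_dist_def)
  moreover have "Min ?S \<in> ?S"
    by (rule Min_in) auto
  ultimately have "graph_dist H x y \<in> ?S" by simp
  then consider
      "graph_dist H x y \<in> (\<lambda>((u, s), (v, t)). s + real (vertex_dist H u v) + t) ` (exits H x \<times> exits H y)"
    | "graph_dist H x y \<in> direct_lengths x y"
    by blast
  then show thesis
  proof cases
    case 1
    then show thesis by (auto intro: route)
  next
    case 2
    then show thesis
      by (cases x; cases y) (auto intro: direct split: if_splits)
  qed
qed

lemma graph_dist_commute: "graph_dist H x y = graph_dist H y x"
proof (cases "x \<in> graph_points H \<and> y \<in> graph_points H")
  case True
  have "graph_dist H x y \<le> graph_dist H y x"
    if "x \<in> graph_points H" "y \<in> graph_points H" for x y :: "('a, 'b) graph_point"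
    using that(2,1)
  proof (cases rule: graph_dist_cases)
    case (route u s v t)
    then show ?thesis
      using graph_dist_le_route[OF that route(2,1)] by (simp add: vertex_dist_commute[of _ u])
  next
    case (direct e s t)
    then show ?thesis
      using graph_dist_le_direct[OF that, of "\<bar>t - s\<bar>"] by simp
  qed
  with True show ?thesis by (meson order_antisym)
qed (auto simp: graph_dist_def)

lemma graph_dist_nonneg: "0 \<le> graph_dist H x y"
proof (cases "x \<in> graph_points H \<and> y \<in> graph_points H")
  case True
  then have "x \<in> graph_points H" "y \<in> graph_points H" by auto
  then show ?thesis
  proof (cases rule: graph_dist_cases)
    case (route u s v t)
    then show ?thesis
      using exits_nonneg[of x] exits_nonneg[of y] True by (metis add_nonneg_nonneg of_nat_0_le_iff)
  qed auto
qed (auto simp: graph_dist_def)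

lemma exits_move:
  assumes "(u, s) \<in> exits H (Interior e t)"
  obtains s' where "(u, s') \<in> exits H (Interior e t')" "s' \<le> s + \<bar>t - t'\<bar>"
  using assms by fastforce

text \<open>The realization of a connected graph is indeed a metric space.\<close>

lemma Metric_space_graph:
  assumes wf: "wf_digraph H"
    and conn: "\<And>u v. u \<in> verts H \<Longrightarrow> v \<in> verts H \<Longrightarrow> (u, v) \<in> (adjacency H)\<^sup>*"
  shows "Metric_space (graph_points H) (graph_dist H)"
proof
  interpret wf_digraph H by (fact wf)
  have exits_verts: "u \<in> verts H" if "x \<in> graph_points H" "(u, s) \<in> exits H x" for x u s
    using that by (auto simp: graph_points_def)
  have exits_cross: "real (vertex_dist H u v) \<le> s + t"
    if "x \<in> graph_points H" "(u, s) \<in> exits H x" "(v, t) \<in> exits H x" for x u s v t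
    using that vertex_dist_arc[of _ H] vertex_dist_commute[of H]
    by (fastforce simp: graph_points_def)
  show "0 \<le> graph_dist H x y" for x y by (fact graph_dist_nonneg)
  show "graph_dist H x y = graph_dist H y x" for x y by (fact graph_dist_commute)
  show "graph_dist H x y = 0 \<longleftrightarrow> x = y"
    if x: "x \<in> graph_points H" and y: "y \<in> graph_points H" for x y
  proof
    assume 0: "graph_dist H x y = 0"
    from x y show "x = y"
    proof (cases rule: graph_dist_cases)
      case (route u s v t)
      with 0 exits_nonneg[OF x route(1)] exits_nonneg[OF y route(2)]
      have "s = 0" "t = 0" "vertex_dist H u v = 0" by linarith+
      moreover from this have "x = Vertex u" "y = Vertex v"
        using x y route(1,2) by (auto simp: graph_points_def)
      moreover have "(u, v) \<in> (adjacency H)\<^sup>*"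
        using conn exits_verts[OF x route(1)] exits_verts[OF y route(2)] by simp
      ultimately show ?thesis by (simp add: vertex_dist_eq_0)
    next
      case (direct e s t)
      with 0 show ?thesis by simp
    qed
  next
    assume "x = y"
    moreover have "graph_dist H x x \<le> 0"
    proof (cases x)
      case (Vertex v)
      then show ?thesis using graph_dist_le_route[OF x x, of v 0 v 0] by simp
    next
      case (Interior e t)
      then show ?thesis using graph_dist_le_direct[OF x x, of 0] by simp
    qed
    ultimately show "graph_dist H x y = 0"
      using graph_dist_nonneg[of H x y] by simp
  qed
  show "graph_dist H x z \<le> graph_dist H x y + graph_dist H y z"
    if x: "x \<in> graph_points H" and y: "y \<in> graph_points H" and z: "z \<in> graph_points H" for x y z
    using x y
  proof (cases rule: graph_dist_cases)
    case xy: (route u s v t)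
    from y z show ?thesis
    proof (cases rule: graph_dist_cases)
      case yz: (route v' t' w r)
      note V = exits_verts[OF x xy(1)] exits_verts[OF y xy(2)]
        exits_verts[OF y yz(1)] exits_verts[OF z yz(2)]
      have "vertex_dist H u w \<le> vertex_dist H u v + vertex_dist H v w"
        "vertex_dist H v w \<le> vertex_dist H v v' + vertex_dist H v' w"
        using V by (auto intro!: vertex_dist_triangle conn)
      then show ?thesis
        using xy(3) yz(3) exits_cross[OF y xy(2) yz(1)] graph_dist_le_route[OF x z xy(1) yz(2)]
        by linarith
    next
      case yz: (direct e t1 t2)
      obtain t' where "(v, t') \<in> exits H z" "t' \<le> t + \<bar>t1 - t2\<bar>"
        using exits_move xy(2) yz(1,2) by metis
      then show ?thesis
        using xy(3) yz(3) graph_dist_le_route[OF x z xy(1)] by fastforce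
    qed
  next
    case xy: (direct e t1 t2)
    from y z show ?thesis
    proof (cases rule: graph_dist_cases)
      case yz: (route v t w r)
      obtain t' where "(v, t') \<in> exits H x" "t' \<le> t + \<bar>t2 - t1\<bar>"
        using exits_move xy(1,2) yz(1) by metis
      then show ?thesis
        using xy(3) yz(3) graph_dist_le_route[OF x z _ yz(2)] by fastforce
    next
      case yz: (direct f s1 s2)
      then show ?thesis
        using xy graph_dist_le_direct[OF x z, of "\<bar>t1 - s2\<bar>"] by auto
    qed
  qed
qed

section \<open>Cayley graphs\<close>

definition cayley_graph :: "('g, 'm) monoid_scheme \<Rightarrow> 'g set \<Rightarrow> ('g, 'g \<times> 'g) pre_digraph" where
  "cayley_graph G A =
     \<lparr>verts = carrier G, arcs = carrier G \<times> A, tail = fst, head = (\<lambda>(g, s). g \<otimes>\<^bsub>G\<^esub> s)\<rparr>"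

lemma Metric_space_cayley_graph:
  assumes "group G" and A: "A \<subseteq> carrier G" and gen: "generate G A = carrier G"
  shows "Metric_space (graph_points (cayley_graph G A)) (graph_dist (cayley_graph G A))"
proof (rule Metric_space_graph)
  interpret group G by (fact assms(1))
  let ?R = "adjacency (cayley_graph G A)"
  show "wf_digraph (cayley_graph G A)"
    using A by unfold_locales (auto simp: cayley_graph_def)
  have ends: "arcs_ends (cayley_graph G A) = {(g, g \<otimes>\<^bsub>G\<^esub> s) | g s. g \<in> carrier G \<and> s \<in> A}"
    by (auto simp: arcs_ends_conv cayley_graph_def image_iff)
  have step: "(g, g \<otimes>\<^bsub>G\<^esub> h) \<in> ?R\<^sup>*" if "h \<in> generate G A" "g \<in> carrier G" for g h
    using that
  proof (induction h arbitrary: g rule: generate.induct)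
    case (incl h)
    then show ?case by (auto simp: ends)
  next
    case (inv h)
    then have "(g \<otimes>\<^bsub>G\<^esub> inv\<^bsub>G\<^esub> h \<otimes>\<^bsub>G\<^esub> h, g \<otimes>\<^bsub>G\<^esub> inv\<^bsub>G\<^esub> h) \<in> ?R"
      using A by (auto simp: ends)
    moreover have "g \<otimes>\<^bsub>G\<^esub> inv\<^bsub>G\<^esub> h \<otimes>\<^bsub>G\<^esub> h = g"
      using A inv by (auto simp: m_assoc)
    ultimately show ?case by auto
  next
    case (eng h1 h2)
    then have "h1 \<in> carrier G" "h2 \<in> carrier G" using gen by auto
    with eng show ?case by (metis m_assoc m_closed rtrancl_trans)
  qed auto
  fix u v assume "u \<in> verts (cayley_graph G A)" "v \<in> verts (cayley_graph G A)"
  then have "u \<in> carrier G" "v \<in> carrier G" by (auto simp: cayley_graph_def)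
  then show "(u, v) \<in> ?R\<^sup>*"
    using step[of "inv\<^bsub>G\<^esub> u \<otimes>\<^bsub>G\<^esub> v" u] gen by (simp add: m_assoc[symmetric])
qed

section \<open>Free groups\<close>

text \<open>
  The free group on a set \<open>S\<close>, realized on the reduced words in letters \<open>(x, True)\<close>, standing for
  \<open>x\<close>, and \<open>(x, False)\<close>, standing for the inverse of \<open>x\<close>.
\<close>

definition inv_letter :: "'x \<times> bool \<Rightarrow> 'x \<times> bool" where
  "inv_letter l = (fst l, \<not> snd l)"

definition reduced :: "('x \<times> bool) list \<Rightarrow> bool" where
  "reduced w \<longleftrightarrow> successively (\<lambda>k l. l \<noteq> inv_letter k) w"

fun reduced_cons :: "'x \<times> bool \<Rightarrow> ('x \<times> bool) list \<Rightarrow> ('x \<times> bool) list" where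
  "reduced_cons l [] = [l]"
| "reduced_cons l (k # w) = (if k = inv_letter l then w else l # k # w)"

definition free_group :: "'x set \<Rightarrow> ('x \<times> bool) list monoid" where
  "free_group S =
     \<lparr>carrier = {w. fst ` set w \<subseteq> S \<and> reduced w}, mult = foldr reduced_cons, one = []\<rparr>"

definition free_gen :: "'x \<Rightarrow> ('x \<times> bool) list" where
  "free_gen x = [(x, True)]"

lemma inv_letter_inv_letter [simp]: "inv_letter (inv_letter l) = l"
  by (simp add: inv_letter_def)

lemma inv_letter_neq [simp]: "inv_letter l \<noteq> l"
  by (simp add: inv_letter_def prod_eq_iff)

lemma fst_inv_letter [simp]: "fst (inv_letter l) = fst l"
  by (simp add: inv_letter_def)

lemma reduced_Nil [simp]: "reduced []"
  by (simp add: reduced_def)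

lemma reduced_Cons: "reduced (l # w) \<longleftrightarrow> reduced w \<and> (w \<noteq> [] \<longrightarrow> hd w \<noteq> inv_letter l)"
  by (auto simp: reduced_def successively_Cons)

lemma reduced_reduced_cons: "reduced w \<Longrightarrow> reduced (reduced_cons l w)"
  by (cases w) (auto simp: reduced_Cons)

lemma reduced_cons_inv: "reduced w \<Longrightarrow> reduced_cons (inv_letter l) (reduced_cons l w) = w"
  by (cases w rule: remdups_adj.cases) (auto simp: reduced_Cons)

lemma reduced_cons_inv': "reduced w \<Longrightarrow> reduced_cons l (reduced_cons (inv_letter l) w) = w"
  using reduced_cons_inv[of w "inv_letter l"] by simp

lemma reduced_foldr: "reduced w \<Longrightarrow> reduced (foldr reduced_cons u w)"
  by (induction u) (auto intro: reduced_reduced_cons)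

lemma set_reduced_cons: "set (reduced_cons l w) \<subseteq> insert l (set w)"
  by (cases w) auto

lemma set_foldr_reduced_cons: "set (foldr reduced_cons u w) \<subseteq> set u \<union> set w"
  by (induction u) (use set_reduced_cons in fastforce)+

lemma foldr_reduced_cons_Nil: "reduced u \<Longrightarrow> foldr reduced_cons u [] = u"
proof (induction u)
  case (Cons l u)
  then show ?case by (cases u) (auto simp: reduced_Cons)
qed simp

lemma foldr_reduced_cons_reduced_cons:
  assumes "reduced w"
  shows "foldr reduced_cons (reduced_cons l v) w = reduced_cons l (foldr reduced_cons v w)"
  using assms by (cases v) (auto simp: reduced_cons_inv' reduced_foldr)

lemma foldr_reduced_cons_assoc:
  assumes "reduced w"
  shows "foldr reduced_cons (foldr reduced_cons u v) w =
    foldr reduced_cons u (foldr reduced_cons v w)"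
  by (induction u) (auto simp: foldr_reduced_cons_reduced_cons[OF assms])

lemma foldr_reduced_cons_inverse:
  "reduced v \<Longrightarrow> foldr reduced_cons (rev (map inv_letter w)) (foldr reduced_cons w v) = v"
  by (induction w arbitrary: v) (auto simp: reduced_cons_inv reduced_foldr)

lemma group_free_group: "group (free_group S)"
proof (rule groupI)
  fix u assume u: "u \<in> carrier (free_group S)"
  let ?v = "foldr reduced_cons (rev (map inv_letter u)) []"
  have "?v \<in> carrier (free_group S)"
    using u set_foldr_reduced_cons[of "rev (map inv_letter u)" "[]"]
    by (fastforce simp: free_group_def reduced_foldr)
  moreover have "?v \<otimes>\<^bsub>free_group S\<^esub> u = \<one>\<^bsub>free_group S\<^esub>"
  proof -
    have "reduced u" using u by (simp add: free_group_def)
    then have "foldr reduced_cons ?v u = foldr reduced_cons (rev (map inv_letter u)) u"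
      by (simp add: foldr_reduced_cons_assoc)
    also have "\<dots> = []"
      using foldr_reduced_cons_inverse[of "[]" u] \<open>reduced u\<close>
      by (simp add: foldr_reduced_cons_Nil)
    finally show ?thesis by (simp add: free_group_def)
  qed
  ultimately show "\<exists>v\<in>carrier (free_group S). v \<otimes>\<^bsub>free_group S\<^esub> u = \<one>\<^bsub>free_group S\<^esub>" by blast
next
  fix u v assume "u \<in> carrier (free_group S)" "v \<in> carrier (free_group S)"
  then show "u \<otimes>\<^bsub>free_group S\<^esub> v \<in> carrier (free_group S)"
    using set_foldr_reduced_cons[of u v] by (fastforce simp: free_group_def reduced_foldr)
qed (auto simp: free_group_def foldr_reduced_cons_assoc)

lemma free_gen_carrier: "x \<in> S \<Longrightarrow> free_gen x \<in> carrier (free_group S)"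
  by (simp add: free_gen_def free_group_def reduced_Cons)

end

theory Submission
  imports Defs "HOL-Library.Sublist"
begin

text \<open>
  For the standard generators the graph is the 1-skeleton of a product of two trees, with distance
  the sum of the two tree distances. Divide a long loop into six arcs of equal length \<open>s\<close>. If all
  three pairs of opposite division points had distance close to \<open>3 s\<close>, the six points would form an
  isometric hexagon; but the three splits of a hexagon cross pairwise, whereas the splits carried by
  a tree do not, so two trees do not suffice. Quantitatively, the four-point condition in each
  tree bounds one of the three distances by \<open>7/3 s\<close>, and the corresponding geodesic is a shortcut.

  With \<open>t = d b\<^sup>-\<^sup>1\<close> in place of \<open>d\<close>, the commutator of \<open>t\<^sup>m c t\<^sup>-\<^sup>m\<close>, an element of the second
  factor, with \<open>a\<close> spells a loop of length \<open>4 m + 4\<close> whose antipodal vertices stay at distance at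
  least \<open>2 m\<close>, which leaves no room for a shortcut of a fixed ratio.
\<close>

section \<open>Lengths of paths\<close>

text \<open>Loops are arbitrary rectifiable paths in the metric realization, not just edge-paths.
  Both halves therefore pass between paths and vertices: a point is moved to a vertex at distance at
  most 1, and the additive errors are absorbed because only long loops count. Any uniform factor
  below 3 in place of 7/3 would serve the positive half in the same way. For the negative half,
  sending b and t to the standard basis and a, c to 0 maps the group onto the integer plane, and
  every edge moves at most 1 in the l1 metric. The a-edge at the root of the first tree can be
  crossed only over the diagonal, where the exponent of b in the first factor is 0; the c-edge
  behind d^m can be crossed only at height m. Climbing the diagonal means multiplying by d = t b,
  which costs two edges per step, so the diagonal is no quicker way to height m than the
  axis.\<close>

lemma sum_lessThan_add:
  fixes f :: "nat \<Rightarrow> 'b :: comm_monoid_add"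
  shows "sum f {..<m + n} = sum f {..<m} + (\<Sum>i<n. f (m + i))"
  by (induction n) (auto simp: add.assoc)

context Metric_space
begin

lemma path_length_upper:
  assumes "mono_on {..n} t" "t ` {..n} \<subseteq> {p..q}"
  shows "ereal (\<Sum>i<n. d (g (t i)) (g (t (Suc i)))) \<le> path_length g p q"
  unfolding path_length_def using assms by (intro SUP_upper2[of "(n, t)"]) auto

lemma path_length_least:
  assumes "\<And>n t. mono_on {..n} t \<Longrightarrow> t ` {..n} \<subseteq> {p..q} \<Longrightarrow>
    ereal (\<Sum>i<n. d (g (t i)) (g (t (Suc i)))) \<le> B"
  shows "path_length g p q \<le> B"
  unfolding path_length_def using assms by (auto intro!: SUP_least)

lemma dist_le_path_length:
  assumes "p \<le> q"
  shows "ereal (d (g p) (g q)) \<le> path_length g p q"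
proof -
  let ?t = "\<lambda>i::nat. if i = 0 then p else q"
  have "mono_on {..1} ?t" "?t ` {..1} \<subseteq> {p..q}" using assms by (auto simp: mono_on_def)
  from path_length_upper[OF this, of g] show ?thesis by simp
qed

lemma path_length_nonneg:
  assumes "p \<le> q"
  shows "0 \<le> path_length g p q"
  using order_trans[OF _ dist_le_path_length[OF assms, of g]] by simp

lemma path_length_refl [simp]:
  assumes "g p \<in> M"
  shows "path_length g p p = 0"
proof (rule antisym)
  show "path_length g p p \<le> 0"
  proof (rule path_length_least)
    fix n and t :: "nat \<Rightarrow> real" assume "t ` {..n} \<subseteq> {p..p}"
    then have "t i = p" if "i \<le> n" for i using that by auto
    then show "ereal (\<Sum>i<n. d (g (t i)) (g (t (Suc i)))) \<le> 0" using assms by simp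
  qed
qed (simp add: path_length_nonneg)

text \<open>Polygons inscribed in the two parts are juxtaposed to a polygon of the whole; the side
  that joins them can only add length.\<close>

lemma path_length_add_le:
  assumes "p \<le> m" "m \<le> q"
  shows "path_length g p m + path_length g m q \<le> path_length g p q"
proof (cases "path_length g p q = \<infinity>")
  case False
  then obtain c where c: "path_length g p q = ereal c"
    using path_length_nonneg[of p q g] assms by (cases "path_length g p q") auto
  have *: "s + u \<le> c"
    if "s = (\<Sum>i<k. d (g (t i)) (g (t (Suc i))))" "u = (\<Sum>i<n. d (g (r i)) (g (r (Suc i))))"
      "mono_on {..k} t" "t ` {..k} \<subseteq> {p..m}" "mono_on {..n} r" "r ` {..n} \<subseteq> {m..q}"
    for s u :: real and k n :: nat and t r :: "nat \<Rightarrow> real"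
  proof -
    \<comment> \<open>The second polygon starts at index \<open>Suc k\<close>, so side number
      \<open>k\<close> of \<open>w\<close> is the joining side.\<close>
    define w where "w i = (if i \<le> k then t i else r (i - Suc k))" for i
    have "mono_on {..k + Suc n} w"
    proof (rule mono_onI)
      fix i j assume ij: "i \<in> {..k + Suc n}" "j \<in> {..k + Suc n}" "i \<le> j"
      consider "j \<le> k" | "i \<le> k" "k < j" | "k < i" using ij by linarith
      then show "w i \<le> w j"
      proof cases
        case 1
        then show ?thesis using ij that(3) by (auto simp: w_def mono_on_def)
      next
        case 2
        then have "t i \<le> m" "m \<le> r (j - Suc k)"
          using that(4,6) ij by (auto simp: image_subset_iff)
        then show ?thesis using 2 by (simp add: w_def)
      next
        case 3
        then show ?thesis using ij that(5) by (auto simp: w_def intro!: mono_onD[of _ r])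
      qed
    qed
    moreover have "w ` {..k + Suc n} \<subseteq> {p..q}"
    proof -
      have *: "\<And>i. i \<le> k \<Longrightarrow> t i \<in> {p..m}" "\<And>i. i \<le> n \<Longrightarrow> r i \<in> {m..q}"
        using \<open>t ` {..k} \<subseteq> {p..m}\<close> \<open>r ` {..n} \<subseteq> {m..q}\<close> by blast+
      have "w i \<in> {p..q}" if "i \<le> k + Suc n" for i
      proof (cases "i \<le> k")
        case True
        then show ?thesis using *(1)[of i] assms by (auto simp: w_def)
      next
        case False
        then have "i - Suc k \<le> n" using that by linarith
        from *(2)[OF this] False show ?thesis using assms by (simp add: w_def)
      qed
      then show ?thesis by auto
    qed
    ultimately have "(\<Sum>i<k + Suc n. d (g (w i)) (g (w (Suc i)))) \<le> c"
      using path_length_upper[of "k + Suc n" w p q g] c by simp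
    also have "(\<Sum>i<k + Suc n. d (g (w i)) (g (w (Suc i)))) =
        (\<Sum>i<k. d (g (w i)) (g (w (Suc i)))) + (\<Sum>i<Suc n. d (g (w (k + i))) (g (w (Suc (k + i)))))"
      by (rule sum_lessThan_add)
    also have "(\<Sum>i<k. d (g (w i)) (g (w (Suc i)))) = s"
      unfolding that by (rule sum.cong) (auto simp: w_def)
    also have "(\<Sum>i<Suc n. d (g (w (k + i))) (g (w (Suc (k + i))))) = d (g (t k)) (g (r 0)) + u"
      unfolding that by (simp only: sum.lessThan_Suc_shift) (simp add: w_def)
    finally show ?thesis using nonneg[of "g (t k)" "g (r 0)"] by linarith
  qed
  \<comment> \<open>The suprema are taken one at a time: with the second polygon fixed, the first
    part is bounded by the real number \<open>c - u\<close>, hence has finite length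
    \<open>e\<close>; then the second part is bounded by \<open>c - e\<close>.\<close>
  have "path_length g p m \<le> ereal (c - u)"
    if "u = (\<Sum>i<n. d (g (r i)) (g (r (Suc i))))" "mono_on {..n} r" "r ` {..n} \<subseteq> {m..q}" for u :: real and n :: nat and r :: "nat \<Rightarrow> real"
    by (rule path_length_least) (use *[OF refl that(1) _ _ that(2,3)] in \<open>simp add: algebra_simps\<close>)
  note 1 = this
  obtain e where e: "path_length g p m = ereal e"
    using path_length_nonneg[of p m g] assms 1[of 0 "\<lambda>_. m" 0]
    by (cases "path_length g p m") (auto simp: mono_on_def)
  have "path_length g m q \<le> ereal (c - e)"
    by (rule path_length_least) (use 1 e in \<open>force simp: algebra_simps\<close>)
  then show ?thesis by (cases "path_length g m q") (auto simp: c e)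
qed simp

text \<open>Clamping the division points to either side of \<open>m\<close> turns a polygon into one
  polygon for each part. The triangle inequality is spent only on the side that straddles
  \<open>m\<close>.\<close>

lemma path_length_le_add:
  assumes "p \<le> m" "m \<le> q" and M: "g ` {p..q} \<subseteq> M"
  shows "path_length g p q \<le> path_length g p m + path_length g m q"
proof (rule path_length_least)
  fix n and t :: "nat \<Rightarrow> real" assume t: "mono_on {..n} t" "t ` {..n} \<subseteq> {p..q}"
  let ?t1 = "\<lambda>i. min (t i) m" and ?t2 = "\<lambda>i. max (t i) m"
  have tM: "g (t i) \<in> M" if "i \<le> n" for i using t(2) M that by blast
  have mM: "g m \<in> M" using M assms by auto
  have "d (g (t i)) (g (t (Suc i))) \<le>
      d (g (?t1 i)) (g (?t1 (Suc i))) + d (g (?t2 i)) (g (?t2 (Suc i)))" if "i < n" for i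
  proof -
    have "t i \<le> t (Suc i)" using t(1) that by (auto simp: mono_on_def)
    then show ?thesis
      using triangle[OF tM mM tM, of i "Suc i"] that mM by (auto simp: min_def max_def)
  qed
  then have "(\<Sum>i<n. d (g (t i)) (g (t (Suc i)))) \<le>
      (\<Sum>i<n. d (g (?t1 i)) (g (?t1 (Suc i)))) + (\<Sum>i<n. d (g (?t2 i)) (g (?t2 (Suc i))))"
    unfolding sum.distrib[symmetric] by (intro sum_mono) auto
  then have "ereal (\<Sum>i<n. d (g (t i)) (g (t (Suc i)))) \<le>
      ereal (\<Sum>i<n. d (g (?t1 i)) (g (?t1 (Suc i)))) + ereal (\<Sum>i<n. d (g (?t2 i)) (g (?t2 (Suc i))))"
    by simp
  also have "\<dots> \<le> path_length g p m + path_length g m q"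
    using t assms by (intro add_mono path_length_upper) (auto simp: mono_on_def intro: min.coboundedI1 max.coboundedI1)
  finally show "ereal (\<Sum>i<n. d (g (t i)) (g (t (Suc i)))) \<le> path_length g p m + path_length g m q" .
qed

lemma path_length_lipschitz:
  assumes "p \<le> q" "0 \<le> C" and lip: "\<And>s t. s \<in> {p..q} \<Longrightarrow> t \<in> {p..q} \<Longrightarrow> d (g s) (g t) \<le> C * \<bar>s - t\<bar>"
  shows "path_length g p q \<le> ereal (C * (q - p))"
proof (rule path_length_least)
  fix n and t :: "nat \<Rightarrow> real" assume t: "mono_on {..n} t" "t ` {..n} \<subseteq> {p..q}"
  have "d (g (t i)) (g (t (Suc i))) \<le> C * (t (Suc i) - t i)" if "i < n" for i
  proof -
    have "t i \<le> t (Suc i)" "t i \<in> {p..q}" "t (Suc i) \<in> {p..q}"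
      using t that unfolding mono_on_def image_subset_iff by auto
    then show ?thesis using lip[of "t i" "t (Suc i)"] by simp
  qed
  then have "(\<Sum>i<n. d (g (t i)) (g (t (Suc i)))) \<le> (\<Sum>i<n. C * (t (Suc i) - t i))"
    by (intro sum_mono) auto
  also have "\<dots> = C * (t n - t 0)"
    by (simp add: sum_lessThan_telescope sum_distrib_left[symmetric])
  also have "\<dots> \<le> C * (q - p)"
  proof -
    have "t 0 \<in> {p..q}" "t n \<in> {p..q}" using t(2) by auto
    then show ?thesis using assms by (intro mult_left_mono) auto
  qed
  finally show "ereal (\<Sum>i<n. d (g (t i)) (g (t (Suc i)))) \<le> ereal (C * (q - p))" by simp
qed

section \<open>Dividing a rectifiable path at a prescribed length\<close>

lemma path_in_space: "pathin mtopology g \<Longrightarrow> 0 \<le> t \<Longrightarrow> t \<le> 1 \<Longrightarrow> g t \<in> M"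
  by (auto simp: pathin_def continuous_map_def)

text \<open>Makes the length of a polygon, clamped at a moving parameter, a continuous function of
  that parameter.\<close>

lemma continuous_on_path_dist:
  assumes g: "pathin mtopology g" and T: "continuous_on T u" "continuous_on T v"
    "u ` T \<subseteq> {0..1}" "v ` T \<subseteq> {0..1}"
  shows "continuous_on T (\<lambda>s. d (g (u s)) (g (v s)))"
proof -
  have *: "continuous_map (top_of_set T) mtopology (\<lambda>s. g (u s))"
    if "continuous_on T u" "u ` T \<subseteq> {0..1}" for u
    using continuous_map_compose[of "top_of_set T" "top_of_set {0..1}" u mtopology g] g that
    by (simp add: pathin_def o_def continuous_map_subtopology_eu image_subset_iff_funcset)
  have "continuous_map (top_of_set T) euclideanreal (\<lambda>s. mdist (metric (M, d)) (g (u s)) (g (v s)))"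
    using *[OF T(1,3)] *[OF T(2,4)]
    by (intro continuous_map_mdist) auto
  then show ?thesis by simp
qed

text \<open>Length is lower semicontinuous in either end of the interval, because a fixed polygon
  clamped at \<open>s\<close> varies continuously with \<open>s\<close>. At the supremum
  \<open>t\<close> of the parameters that use length at most \<open>x\<close>, the first bound is a
  limit from within \<open>S\<close>; the second is a limit from \<open>s > t\<close>, where more
  than \<open>x\<close> has already been used.\<close>

lemma path_split:
  assumes g: "pathin mtopology g" and pq: "0 \<le> p" "p \<le> q" "q \<le> 1"
    and l: "path_length g p q = ereal l" and x: "0 \<le> x" "x \<le> l"
  obtains t where "p \<le> t" "t \<le> q" "path_length g p t \<le> ereal x" "path_length g t q \<le> ereal (l - x)"
proof -
  define S where "S = {t \<in> {p..q}. path_length g p t \<le> ereal x}"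
  have pM: "g s \<in> M" if "s \<in> {p..q}" for s using path_in_space[OF g] that pq by auto
  have pS: "p \<in> S" using pM[of p] pq x by (auto simp: S_def zero_ereal_def[symmetric])
  have bdd: "bdd_above S" by (auto simp: S_def bdd_above_def)
  have Sp: "S \<subseteq> {p..q}" by (auto simp: S_def)
  define t where "t = Sup S"
  have t: "p \<le> t" "t \<le> q"
    unfolding t_def using cSup_upper[OF pS bdd] pS Sp by (auto intro!: cSup_least)
  have cl: "t \<in> closure S" unfolding t_def using pS bdd by (intro closure_contains_Sup) auto
  have "path_length g p t \<le> ereal x"
  proof (rule path_length_least)
    fix n and r :: "nat \<Rightarrow> real" assume r: "mono_on {..n} r" "r ` {..n} \<subseteq> {p..t}"
    let ?f = "\<lambda>s. \<Sum>i<n. d (g (min (r i) s)) (g (min (r (Suc i)) s))"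
    have rp: "p \<le> r i" "r i \<le> t" if "i \<le> n" for i using r(2) that by auto
    have "?f t \<le> x"
    proof (rule continuous_le_on_closure[OF _ cl])
      have clS: "closure S \<subseteq> {p..q}" using closure_mono[OF Sp] by simp
      have "0 \<le> s" if "s \<in> closure S" for s using subsetD[OF clS that] pq(1) by simp
      then have "(\<lambda>s. min (r i) s) ` closure S \<subseteq> {0..1}" if "i \<le> n" for i
        using rp[OF that] t pq by (intro image_subsetI) (simp add: min_def)
      then show "continuous_on (closure S) ?f"
        by (intro continuous_on_sum continuous_on_path_dist[OF g] continuous_intros) simp_all
      show "?f s \<le> x" if "s \<in> S" for s
      proof -
        have "mono_on {..n} (\<lambda>i. min (r i) s)"
          using r(1) unfolding mono_on_def by (meson min.mono order_refl)
        moreover have "(\<lambda>i. min (r i) s) ` {..n} \<subseteq> {p..s}"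
          using rp that Sp by (intro image_subsetI) auto
        ultimately have "ereal (?f s) \<le> path_length g p s"
          by (rule path_length_upper)
        also have "\<dots> \<le> ereal x" using that by (simp add: S_def)
        finally show ?thesis by simp
      qed
    qed
    moreover have "?f t = (\<Sum>i<n. d (g (r i)) (g (r (Suc i))))"
      using rp by (intro sum.cong) (auto simp: min_absorb1)
    ultimately show "ereal (\<Sum>i<n. d (g (r i)) (g (r (Suc i)))) \<le> ereal x" by simp
  qed
  moreover have "path_length g t q \<le> ereal (l - x)"
  proof (cases "t = q")
    case True
    then show ?thesis using pM[of q] pq x by (simp add: zero_ereal_def)
  next
    case False
    then have "t < q" using t by simp
    have cl: "t \<in> closure {t<..q}" using \<open>t < q\<close> by simp
    show ?thesis
    proof (rule path_length_least)
      fix n and r :: "nat \<Rightarrow> real" assume r: "mono_on {..n} r" "r ` {..n} \<subseteq> {t..q}"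
      let ?f = "\<lambda>s. \<Sum>i<n. d (g (max (r i) s)) (g (max (r (Suc i)) s))"
      have rp: "t \<le> r i" "r i \<le> q" if "i \<le> n" for i using r(2) that by auto
      have "?f t \<le> l - x"
      proof (rule continuous_le_on_closure[OF _ cl])
        have "(\<lambda>s. max (r i) s) ` closure {t<..q} \<subseteq> {0..1}" if "i \<le> n" for i
            using rp[OF that] t pq \<open>t < q\<close> by (intro image_subsetI) (simp add: max_def)
        then show "continuous_on (closure {t<..q}) ?f"
          by (intro continuous_on_sum continuous_on_path_dist[OF g] continuous_intros) simp_all
        show "?f s \<le> l - x" if s: "s \<in> {t<..q}" for s
        proof -
          have "s \<notin> S" using cSup_upper[OF _ bdd, of s] s by (auto simp: t_def)
          then have "ereal x < path_length g p s" using s t by (auto simp: S_def)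
          moreover have "path_length g p s + path_length g s q \<le> ereal l"
            using path_length_add_le[of p s q g] s t l by simp
          moreover have "ereal (?f s) \<le> path_length g s q"
          proof (rule path_length_upper)
            show "mono_on {..n} (\<lambda>i. max (r i) s)"
              using r(1) unfolding mono_on_def by (meson max.mono order_refl)
            show "(\<lambda>i. max (r i) s) ` {..n} \<subseteq> {s..q}"
              using rp s by (intro image_subsetI) auto
          qed
          ultimately show ?thesis
            by (cases "path_length g p s"; cases "path_length g s q") auto
        qed
      qed
      moreover have "?f t = (\<Sum>i<n. d (g (r i)) (g (r (Suc i))))"
        using rp by (intro sum.cong) (auto simp: max_absorb1)
      ultimately show "ereal (\<Sum>i<n. d (g (r i)) (g (r (Suc i)))) \<le> ereal (l - x)" by simp
    qed
  qed
  ultimately show thesis using that t by blast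
qed

text \<open>Upper bounds alone let divisions be iterated without tracking exact lengths. If the
  whole arc has length at most \<open>x\<close>, the division point is its end
  \<open>q\<close>.\<close>

lemma path_split_le:
  assumes g: "pathin mtopology g" and pq: "0 \<le> p" "p \<le> q" "q \<le> 1"
    and xy: "path_length g p q \<le> ereal (x + y)" "0 \<le> x" "0 \<le> y"
  obtains t where "p \<le> t" "t \<le> q" "path_length g p t \<le> ereal x" "path_length g t q \<le> ereal y"
proof -
  obtain l where l: "path_length g p q = ereal l"
    using path_length_nonneg[of p q g] pq xy(1) by (cases "path_length g p q") auto
  show thesis
  proof (cases "l \<le> x")
    case True
    then show ?thesis
      using that[of q] pq l xy path_in_space[OF g, of q] by (simp add: zero_ereal_def)
  next
    case False
    then obtain t where "p \<le> t" "t \<le> q" "path_length g p t \<le> ereal x" "path_length g t q \<le> ereal (l - x)"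
      using path_split[OF g pq l xy(2)] by auto
    moreover have "ereal (l - x) \<le> ereal y" using l xy(1) by simp
    ultimately show ?thesis using that[of t] order_trans by blast
  qed
qed

end

section \<open>Unit speed curves\<close>

context Metric_space
begin

text \<open>Only a 1-Lipschitz bound is imposed, so a curve may pause or backtrack. Such curves are
  closed under joining by the triangle inequality, and \<open>c\<close> is an upper bound for the
  length.\<close>

definition unit_speed :: "(real \<Rightarrow> 'a) \<Rightarrow> real \<Rightarrow> bool" where
  "unit_speed \<gamma> c \<longleftrightarrow> 0 \<le> c \<and> \<gamma> ` {0..c} \<subseteq> M \<and>
     (\<forall>s\<in>{0..c}. \<forall>t\<in>{0..c}. d (\<gamma> s) (\<gamma> t) \<le> \<bar>s - t\<bar>)"

lemma unit_speedI:
  assumes "0 \<le> c" "\<And>s. 0 \<le> s \<Longrightarrow> s \<le> c \<Longrightarrow> \<gamma> s \<in> M"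
    "\<And>s t. 0 \<le> s \<Longrightarrow> s \<le> t \<Longrightarrow> t \<le> c \<Longrightarrow> d (\<gamma> s) (\<gamma> t) \<le> t - s"
  shows "unit_speed \<gamma> c"
  unfolding unit_speed_def
proof (intro conjI ballI)
  fix s t assume "s \<in> {0..c}" "t \<in> {0..c}"
  then show "d (\<gamma> s) (\<gamma> t) \<le> \<bar>s - t\<bar>"
    using assms(3)[of s t] assms(3)[of t s] by (cases "s \<le> t") (auto simp: commute)
qed (use assms in auto)

lemma unit_speed_in_space: "unit_speed \<gamma> c \<Longrightarrow> 0 \<le> s \<Longrightarrow> s \<le> c \<Longrightarrow> \<gamma> s \<in> M"
  by (auto simp: unit_speed_def)

lemma unit_speed_dist:
  "unit_speed \<gamma> c \<Longrightarrow> 0 \<le> s \<Longrightarrow> s \<le> c \<Longrightarrow> 0 \<le> t \<Longrightarrow> t \<le> c \<Longrightarrow> d (\<gamma> s) (\<gamma> t) \<le> \<bar>s - t\<bar>"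
  by (auto simp: unit_speed_def)

lemma unit_speed_nonneg: "unit_speed \<gamma> c \<Longrightarrow> 0 \<le> c"
  by (simp add: unit_speed_def)

lemma unit_speed_const: "x \<in> M \<Longrightarrow> unit_speed (\<lambda>_. x) 0"
  by (auto simp: unit_speed_def)

lemma unit_speed_reverse:
  assumes "unit_speed \<gamma> c"
  shows "unit_speed (\<lambda>s. \<gamma> (c - s)) c"
proof (rule unit_speedI)
  fix s t assume "0 \<le> s" "s \<le> t" "t \<le> c"
  then show "d (\<gamma> (c - s)) (\<gamma> (c - t)) \<le> t - s"
    using unit_speed_dist[OF assms, of "c - s" "c - t"] by simp
qed (use unit_speed_nonneg[OF assms] unit_speed_in_space[OF assms] in auto)

lemma unit_speed_segment:
  assumes "unit_speed \<gamma> c" "0 \<le> p" "p \<le> q" "q \<le> c"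
  shows "unit_speed (\<lambda>s. \<gamma> (p + s)) (q - p)"
proof (rule unit_speedI)
  fix s t assume "0 \<le> s" "s \<le> t" "t \<le> q - p"
  then show "d (\<gamma> (p + s)) (\<gamma> (p + t)) \<le> t - s"
    using unit_speed_dist[OF assms(1), of "p + s" "p + t"] assms by simp
qed (use assms unit_speed_in_space[OF assms(1)] in auto)

lemma unit_speed_join:
  assumes \<gamma>: "unit_speed \<gamma> c" and \<delta>: "unit_speed \<delta> e" and eq: "\<gamma> c = \<delta> 0"
  shows "unit_speed (\<lambda>s. if s \<le> c then \<gamma> s else \<delta> (s - c)) (c + e)"
proof (rule unit_speedI)
  note ce = unit_speed_nonneg[OF \<gamma>] unit_speed_nonneg[OF \<delta>]
  then show "0 \<le> c + e" by simp
  show "(if s \<le> c then \<gamma> s else \<delta> (s - c)) \<in> M" if "0 \<le> s" "s \<le> c + e" for s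
    using that unit_speed_in_space[OF \<gamma>, of s] unit_speed_in_space[OF \<delta>, of "s - c"] by auto
  fix s t assume st: "0 \<le> s" "s \<le> t" "t \<le> c + e"
  consider "t \<le> c" | "s \<le> c" "c < t" | "c < s" by linarith
  then show "d (if s \<le> c then \<gamma> s else \<delta> (s - c)) (if t \<le> c then \<gamma> t else \<delta> (t - c)) \<le> t - s"
  proof cases
    case 1
    then show ?thesis using st unit_speed_dist[OF \<gamma>, of s t] by simp
  next
    case 2
    have "d (\<gamma> s) (\<delta> (t - c)) \<le> d (\<gamma> s) (\<gamma> c) + d (\<delta> 0) (\<delta> (t - c))"
      using triangle[of "\<gamma> s" "\<gamma> c" "\<delta> (t - c)"] 2 st ce eq
        unit_speed_in_space[OF \<gamma>, of s] unit_speed_in_space[OF \<gamma>, of c]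
        unit_speed_in_space[OF \<delta>, of "t - c"] by simp
    also have "\<dots> \<le> (c - s) + (t - c)"
      using 2 st ce unit_speed_dist[OF \<gamma>, of s c] unit_speed_dist[OF \<delta>, of 0 "t - c"] by simp
    finally show ?thesis using 2 by simp
  next
    case 3
    then show ?thesis using st unit_speed_dist[OF \<delta>, of "s - c" "t - c"] by simp
  qed
qed

lemma unit_speed_rescaled_dist:
  assumes "unit_speed \<gamma> c" "s \<in> {0..1}" "t \<in> {0..1}"
  shows "d (\<gamma> (c * s)) (\<gamma> (c * t)) \<le> c * \<bar>s - t\<bar>"
proof -
  have "c * s \<le> c" "c * t \<le> c"
    using assms unit_speed_nonneg[OF assms(1)] by (auto simp: mult_left_le)
  then have "d (\<gamma> (c * s)) (\<gamma> (c * t)) \<le> \<bar>c * s - c * t\<bar>"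
    using assms unit_speed_nonneg[OF assms(1)] by (intro unit_speed_dist[OF assms(1)]) auto
  also have "\<dots> = c * \<bar>s - t\<bar>"
    using unit_speed_nonneg[OF assms(1)] by (simp add: right_diff_distrib[symmetric] abs_mult)
  finally show ?thesis .
qed

lemma unit_speed_rescaled_in_space:
  assumes "unit_speed \<gamma> c" "s \<in> {0..1}"
  shows "\<gamma> (c * s) \<in> M"
  using assms unit_speed_nonneg[OF assms(1)]
  by (intro unit_speed_in_space[OF assms(1)]) (auto simp: mult_left_le)

lemma pathin_unit_speed:
  assumes \<gamma>: "unit_speed \<gamma> c"
  shows "pathin mtopology (\<lambda>s. \<gamma> (c * s))"
  unfolding pathin_def continuous_map_to_metric
proof (intro ballI allI impI)
  fix x \<epsilon> :: real assume x: "x \<in> topspace (top_of_set {0..1})" and \<epsilon>: "0 < \<epsilon>"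
  \<comment> \<open>The radius has \<open>c + 1\<close> in the denominator because constant curves
    have \<open>c = 0\<close>.\<close>
  define U where "U = {0..1} \<inter> ball x (\<epsilon> / (c + 1))"
  have c: "0 \<le> c" by (rule unit_speed_nonneg[OF \<gamma>])
  have "\<gamma> (c * y) \<in> mball (\<gamma> (c * x)) \<epsilon>" if "y \<in> U" for y
  proof -
    have y: "y \<in> {0..1}" "\<bar>x - y\<bar> < \<epsilon> / (c + 1)" using that by (auto simp: U_def dist_real_def)
    have "d (\<gamma> (c * x)) (\<gamma> (c * y)) \<le> c * \<bar>x - y\<bar>"
      using x y by (intro unit_speed_rescaled_dist[OF \<gamma>]) auto
    also have "\<dots> \<le> (c + 1) * \<bar>x - y\<bar>" by (intro mult_right_mono) auto
    also have "\<dots> < \<epsilon>" using y(2) c by (simp add: field_simps)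
    finally show ?thesis using x y unit_speed_rescaled_in_space[OF \<gamma>] by simp
  qed
  moreover have "openin (top_of_set {0..1}) U" "x \<in> U"
    using x \<epsilon> c by (auto simp: U_def)
  ultimately show "\<exists>U. openin (top_of_set {0..1}) U \<and> x \<in> U \<and>
      (\<forall>y\<in>U. \<gamma> (c * y) \<in> mball (\<gamma> (c * x)) \<epsilon>)" by blast
qed

lemma path_length_unit_speed:
  assumes "unit_speed \<gamma> c" "0 \<le> p" "p \<le> q" "q \<le> 1"
  shows "path_length (\<lambda>s. \<gamma> (c * s)) p q \<le> ereal (c * (q - p))"
  using assms unit_speed_nonneg[OF assms(1)]
  by (intro path_length_lipschitz unit_speed_rescaled_dist[OF assms(1)]) auto

end

section \<open>Edges, edge-paths and geodesics as curves in the realization\<close>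

definition edge_point :: "('v, 'e) pre_digraph \<Rightarrow> 'e \<Rightarrow> real \<Rightarrow> ('v, 'e) graph_point" where
  "edge_point H e t =
     (if t \<le> 0 then Vertex (tail H e) else if 1 \<le> t then Vertex (head H e) else Interior e t)"

locale connected_realization =
  fixes H :: "('v, 'e) pre_digraph"
  assumes wf: "wf_digraph H"
    and connected: "u \<in> verts H \<Longrightarrow> v \<in> verts H \<Longrightarrow> (u, v) \<in> (adjacency H)\<^sup>*"
begin

sublocale Metric_space "graph_points H" "graph_dist H"
  by (rule Metric_space_graph[OF wf connected])

lemma Vertex_in_graph_points [simp]: "Vertex v \<in> graph_points H \<longleftrightarrow> v \<in> verts H"
  by (auto simp: graph_points_def)

lemma graph_dist_Vertex:
  assumes "u \<in> verts H" "v \<in> verts H"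
  shows "graph_dist H (Vertex u) (Vertex v) = vertex_dist H u v"
  using assms by (simp add: graph_dist_def)

lemma unit_speed_edge_point:
  assumes e: "e \<in> arcs H"
  shows "unit_speed (edge_point H e) 1"
proof (rule unit_speedI)
  have V: "tail H e \<in> verts H" "head H e \<in> verts H"
    using wf e by (auto simp: wf_digraph_def)
  show in_points: "edge_point H e s \<in> graph_points H" for s
    using e V by (auto simp: edge_point_def graph_points_def)
  fix s t :: real assume st: "0 \<le> s" "s \<le> t" "t \<le> 1"
  note route = graph_dist_le_route[OF in_points in_points, of _ _ s _ _ t]
  consider "t \<le> 0" | "1 \<le> s" | "s \<le> 0" "1 \<le> t" | "s \<le> 0" "0 < t" "t < 1"
    | "0 < s" "s < 1" "1 \<le> t" | "0 < s" "t < 1" by linarith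
  then show "graph_dist H (edge_point H e s) (edge_point H e t) \<le> t - s"
  proof cases
    case 1
    with st show ?thesis using V by (simp add: edge_point_def graph_dist_Vertex)
  next
    case 2
    with st show ?thesis using V by (simp add: edge_point_def graph_dist_Vertex)
  next
    case 3
    with st show ?thesis
      using V vertex_dist_arc[OF e] by (simp add: edge_point_def graph_dist_Vertex)
  next
    case 4
    with st show ?thesis
      using route[of "tail H e" 0 "tail H e" t] by (simp add: edge_point_def)
  next
    case 5
    with st show ?thesis
      using route[of "head H e" "1 - s" "head H e" 0] by (simp add: edge_point_def)
  next
    case 6
    with st show ?thesis
      using graph_dist_le_direct[OF in_points in_points, of "t - s" s t] by (simp add: edge_point_def)
  qed
qed simp

lemma unit_speed_adjacency:
  assumes "(u, v) \<in> adjacency H"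
  obtains \<gamma> where "unit_speed \<gamma> 1" "\<gamma> 0 = Vertex u" "\<gamma> 1 = Vertex v"
proof -
  obtain e where e: "e \<in> arcs H" and "(u = tail H e \<and> v = head H e) \<or> (v = tail H e \<and> u = head H e)"
    using assms by (auto simp: arcs_ends_conv)
  then show thesis
    using that[OF unit_speed_edge_point[OF e]] that[OF unit_speed_reverse[OF unit_speed_edge_point[OF e]]]
    by (auto simp: edge_point_def)
qed

lemma unit_speed_walk:
  assumes "g 0 \<in> verts H" "\<And>k. k < n \<Longrightarrow> (g k, g (Suc k)) \<in> adjacency H"
  obtains \<gamma> where "unit_speed \<gamma> (real n)" "\<And>k. k \<le> n \<Longrightarrow> \<gamma> (real k) = Vertex (g k)"
proof -
  have "\<exists>\<gamma>. unit_speed \<gamma> (real n) \<and> (\<forall>k\<le>n. \<gamma> (real k) = Vertex (g k))"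
    using assms(2)
  proof (induction n)
    case 0
    then show ?case using unit_speed_const[of "Vertex (g 0)"] assms(1) by auto
  next
    case (Suc n)
    then obtain \<gamma> where \<gamma>: "unit_speed \<gamma> (real n)" "\<And>k. k \<le> n \<Longrightarrow> \<gamma> (real k) = Vertex (g k)"
      by (metis less_Suc_eq)
    obtain \<delta> where \<delta>: "unit_speed \<delta> 1" "\<delta> 0 = Vertex (g n)" "\<delta> 1 = Vertex (g (Suc n))"
      using unit_speed_adjacency[of "g n" "g (Suc n)"] Suc.prems[of n] by auto
    have "unit_speed (\<lambda>s. if s \<le> real n then \<gamma> s else \<delta> (s - real n)) (real (Suc n))"
      using unit_speed_join[OF \<gamma>(1) \<delta>(1)] \<gamma>(2)[of n] \<delta>(2) by (simp add: add.commute)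
    then show ?case
      using \<gamma>(2) \<delta>(3) by (intro exI conjI) (auto simp: le_Suc_eq)
  qed
  then show thesis using that by blast
qed

lemma unit_speed_vertex_dist:
  assumes "u \<in> verts H" "v \<in> verts H"
  obtains \<gamma> where "unit_speed \<gamma> (vertex_dist H u v)" "\<gamma> 0 = Vertex u" "\<gamma> (vertex_dist H u v) = Vertex v"
proof -
  obtain g where g: "g 0 = u" "g (vertex_dist H u v) = v"
      "\<And>k. k < vertex_dist H u v \<Longrightarrow> (g k, g (Suc k)) \<in> adjacency H"
    using relpow_vertex_dist[OF connected[OF assms]] unfolding relpow_fun_conv by blast
  then show thesis
    using unit_speed_walk[of g "vertex_dist H u v"] assms(1) that
    by (metis le0 le_refl of_nat_0)
qed

text \<open>Division points of a loop may lie inside edges, whereas the hexagon condition concerns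
  vertices. An interior point runs along its edge to the head.\<close>

lemma unit_speed_to_vertex:
  assumes "x \<in> graph_points H"
  obtains v \<gamma> c where "v \<in> verts H" "unit_speed \<gamma> c" "c \<le> 1" "\<gamma> 0 = x" "\<gamma> c = Vertex v"
proof (cases x)
  case (Vertex v)
  then show ?thesis using assms that[of v "\<lambda>_. x" 0] unit_speed_const[of x] by simp
next
  case (Interior e t)
  then have et: "e \<in> arcs H" "0 < t" "t < 1" using assms by (auto simp: graph_points_def)
  moreover have "head H e \<in> verts H" using wf et by (auto simp: wf_digraph_def)
  ultimately show ?thesis
    using that[OF _ unit_speed_segment[OF unit_speed_edge_point[OF et(1)], of t 1]] Interior
    by (simp add: edge_point_def)
qed

end

section \<open>Two criteria for the shortcut property\<close>

context Metric_space
begin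

lemma dist2_le_path_length:
  assumes "p \<le> m" "m \<le> q"
  shows "ereal (d (g p) (g m) + d (g m) (g q)) \<le> path_length g p q"
proof -
  have "ereal (d (g p) (g m)) + ereal (d (g m) (g q)) \<le> path_length g p m + path_length g m q"
    using assms by (intro add_mono dist_le_path_length)
  also have "\<dots> \<le> path_length g p q" using assms by (rule path_length_add_le)
  finally show ?thesis by simp
qed

text \<open>
  One of the two loops contains both \<open>\<rho> p\<close> and the antipode of \<open>\<rho> p\<close>, so it has length at least
  twice the distance between them.
\<close>

lemma subdivision_antipodal:
  assumes pq: "0 \<le> p" "p \<le> q" "q \<le> 1"
    and in_space: "\<And>s. 0 \<le> s \<Longrightarrow> s \<le> 1 \<Longrightarrow> \<rho> s \<in> M" and "\<rho> 0 = \<rho> 1"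
    and ends: "\<mu> 0 = \<rho> p" "\<mu> 1 = \<rho> q"
    and far: "\<And>s. 0 \<le> s \<Longrightarrow> s \<le> 1 / 2 \<Longrightarrow> E \<le> d (\<rho> s) (\<rho> (s + 1 / 2))"
    and loops: "path_length \<rho> p q + path_length \<mu> 0 1 \<le> ereal B"
      "path_length \<rho> q 1 + path_length \<rho> 0 p + path_length \<mu> 0 1 \<le> ereal B"
  shows "2 * E \<le> B"
proof -
  have \<mu>: "ereal (d (\<rho> p) (\<rho> q)) \<le> path_length \<mu> 0 1"
    using dist_le_path_length[of 0 1 \<mu>] ends by simp
  have M: "\<rho> 0 \<in> M" "\<rho> 1 \<in> M" "\<rho> p \<in> M" "\<rho> q \<in> M" using in_space pq by auto
  \<comment> \<open>The antipode of \<open>\<rho> p\<close> lies on \<open>[p, q]\<close>, on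
    \<open>[q, 1]\<close> or, if \<open>p > 1 / 2\<close>, on \<open>[0, p]\<close>. In each case
    the loop containing it joins it to \<open>\<rho> p\<close> in two ways, and each way has length
    at least \<open>E\<close>.\<close>
  consider "p + 1 / 2 \<le> q" | "q < p + 1 / 2" "p \<le> 1 / 2" | "1 / 2 < p" by linarith
  then show ?thesis
  proof cases
    case 1
    let ?m = "p + 1 / 2"
    have m: "\<rho> ?m \<in> M" using in_space[of ?m] 1 pq by simp
    have "ereal (d (\<rho> p) (\<rho> ?m) + d (\<rho> ?m) (\<rho> q)) + ereal (d (\<rho> p) (\<rho> q)) \<le> ereal B"
      by (rule order_trans[OF add_mono[OF dist2_le_path_length \<mu>] loops(1)]) (use 1 in auto)
    moreover have "d (\<rho> p) (\<rho> ?m) \<le> d (\<rho> p) (\<rho> q) + d (\<rho> ?m) (\<rho> q)"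
      using triangle[of "\<rho> p" "\<rho> q" "\<rho> ?m"] M m by (simp add: commute)
    ultimately show ?thesis using far[of p] 1 pq by simp
  next
    case 2
    let ?m = "p + 1 / 2"
    have m: "\<rho> ?m \<in> M" using in_space[of ?m] 2 pq by simp
    have "ereal (d (\<rho> q) (\<rho> ?m) + d (\<rho> ?m) (\<rho> 1)) + ereal (d (\<rho> 0) (\<rho> p)) + ereal (d (\<rho> p) (\<rho> q)) \<le> ereal B"
      by (rule order_trans[OF add_mono[OF add_mono[OF dist2_le_path_length dist_le_path_length] \<mu>] loops(2)])
        (use 2 pq in auto)
    moreover have "d (\<rho> p) (\<rho> ?m) \<le> d (\<rho> p) (\<rho> q) + d (\<rho> q) (\<rho> ?m)"
      using triangle M m by blast
    moreover have "d (\<rho> p) (\<rho> ?m) \<le> d (\<rho> 0) (\<rho> p) + d (\<rho> ?m) (\<rho> 1)"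
      using triangle[of "\<rho> p" "\<rho> 0" "\<rho> ?m"] M m assms(5) by (simp add: commute)
    ultimately show ?thesis using far[of p] 2 pq by simp
  next
    case 3
    let ?m = "p - 1 / 2"
    have m: "\<rho> ?m \<in> M" using in_space[of ?m] 3 pq by simp
    have "ereal (d (\<rho> q) (\<rho> 1)) + ereal (d (\<rho> 0) (\<rho> ?m) + d (\<rho> ?m) (\<rho> p)) + ereal (d (\<rho> p) (\<rho> q)) \<le> ereal B"
      by (rule order_trans[OF add_mono[OF add_mono[OF dist_le_path_length dist2_le_path_length] \<mu>] loops(2)])
        (use 3 pq in auto)
    moreover have "d (\<rho> ?m) (\<rho> p) \<le> d (\<rho> 0) (\<rho> ?m) + d (\<rho> 0) (\<rho> p)"
      using triangle[of "\<rho> ?m" "\<rho> 0" "\<rho> p"] M m by (simp add: commute)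
    moreover have "d (\<rho> 0) (\<rho> p) \<le> d (\<rho> q) (\<rho> 1) + d (\<rho> p) (\<rho> q)"
      using triangle[of "\<rho> 1" "\<rho> q" "\<rho> p"] M assms(5) by (simp add: commute)
    ultimately show ?thesis using far[of ?m] 3 pq by simp
  qed
qed

end

context connected_realization
begin

lemma vertex_dist_le_graph_dist:
  assumes "x \<in> graph_points H" "y \<in> graph_points H"
    and \<gamma>: "unit_speed \<gamma> c" "c \<le> 1" "\<gamma> 0 = x" "\<gamma> c = Vertex u"
    and \<delta>: "unit_speed \<delta> e" "e \<le> 1" "\<delta> 0 = y" "\<delta> e = Vertex v"
  shows "vertex_dist H u v \<le> graph_dist H x y + 2"
proof -
  have uv: "u \<in> verts H" "v \<in> verts H"
    using unit_speed_in_space[OF \<gamma>(1), of c] unit_speed_in_space[OF \<delta>(1), of e]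
      unit_speed_nonneg[OF \<gamma>(1)] unit_speed_nonneg[OF \<delta>(1)] \<gamma>(4) \<delta>(4) by auto
  have "graph_dist H x (Vertex u) \<le> 1" "graph_dist H y (Vertex v) \<le> 1"
    using unit_speed_dist[OF \<gamma>(1), of 0 c] unit_speed_dist[OF \<delta>(1), of 0 e]
      unit_speed_nonneg[OF \<gamma>(1)] unit_speed_nonneg[OF \<delta>(1)] \<gamma> \<delta> by auto
  moreover have "graph_dist H (Vertex u) (Vertex v) \<le> graph_dist H x (Vertex u) + graph_dist H x y + graph_dist H y (Vertex v)"
    using triangle[of "Vertex u" x "Vertex v"] triangle[of x y "Vertex v"] uv assms(1,2)
    by (simp add: commute)
  ultimately show ?thesis using graph_dist_Vertex[OF uv] by linarith
qed

text \<open>Opposite division points are 3 arcs apart on either side. Since 7/3 is less than 3, a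
  geodesic between nearby vertices still saves a fixed proportion after the detours to these
  vertices are added, provided that the loop is long.\<close>

theorem strongly_shortcut_hexagons:
  assumes hexagon: "\<And>v r. (\<And>i. i < 6 \<Longrightarrow> v i \<in> verts H) \<Longrightarrow>
      (\<And>i. i < 6 \<Longrightarrow> real (vertex_dist H (v i) (v (Suc i mod 6))) \<le> r) \<Longrightarrow>
      \<exists>j<3. 3 * real (vertex_dist H (v j) (v (j + 3))) \<le> 7 * r"
  shows strongly_shortcut
  unfolding strongly_shortcut_def
\<comment> \<open>Moving the division points to vertices lengthens a side to at most
  \<open>s + 2\<close> and adds 2 to the detour. The total \<open>7 / 3 * (s + 2) + 2\<close> is at
  most \<open>5 / 2 * s\<close> once \<open>s\<close> is at least 40, that is, once the length
  \<open>6 * s\<close> is at least 240. Together with half of the loop this gives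
  \<open>3 * s + 5 / 2 * s\<close>, which is 11/12 of \<open>6 * s\<close>.\<close>
proof (rule exI[of _ 240], rule conjI, simp, rule exI[of _ "11 / 12"], rule conjI, simp, intro allI impI)
  fix \<rho> assume "loop_in \<rho> \<and> ereal 240 \<le> path_length \<rho> 0 1 \<and> path_length \<rho> 0 1 < \<infinity>"
  then have \<rho>: "pathin mtopology \<rho>" "\<rho> 0 = \<rho> 1" and long: "ereal 240 \<le> path_length \<rho> 0 1"
    and fin: "path_length \<rho> 0 1 < \<infinity>" by (auto simp: loop_in_def)
  obtain l where l: "path_length \<rho> 0 1 = ereal l"
    using long fin by (cases "path_length \<rho> 0 1") auto
  define s where "s = l / 6"
  have s: "40 \<le> s" "l = 6 * s" using long l by (auto simp: s_def)
  note split = path_split_le[OF \<rho>(1)]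
  obtain t3 where t3: "0 \<le> t3" "t3 \<le> 1" "path_length \<rho> 0 t3 \<le> ereal (3 * s)" "path_length \<rho> t3 1 \<le> ereal (3 * s)"
    using split[of 0 1 "3 * s" "3 * s"] s l by auto
  obtain t1 where t1: "0 \<le> t1" "t1 \<le> t3" "path_length \<rho> 0 t1 \<le> ereal s" "path_length \<rho> t1 t3 \<le> ereal (2 * s)"
    using split[of 0 t3 s "2 * s"] s t3 by auto
  obtain t2 where t2: "t1 \<le> t2" "t2 \<le> t3" "path_length \<rho> t1 t2 \<le> ereal s" "path_length \<rho> t2 t3 \<le> ereal s"
    using split[of t1 t3 s s] s t3 t1 by auto
  obtain t4 where t4: "t3 \<le> t4" "t4 \<le> 1" "path_length \<rho> t3 t4 \<le> ereal s" "path_length \<rho> t4 1 \<le> ereal (2 * s)"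
    using split[of t3 1 s "2 * s"] s t3 by auto
  obtain t5 where t5: "t4 \<le> t5" "t5 \<le> 1" "path_length \<rho> t4 t5 \<le> ereal s" "path_length \<rho> t5 1 \<le> ereal s"
    using split[of t4 1 s s] s t3 t4 by auto
  have add: "path_length \<rho> p q \<le> ereal (x + y)"
    if "0 \<le> p" "p \<le> m" "m \<le> q" "q \<le> 1" "path_length \<rho> p m \<le> ereal x" "path_length \<rho> m q \<le> ereal y" for p m q x y
  proof -
    have "path_length \<rho> p q \<le> path_length \<rho> p m + path_length \<rho> m q"
      using that path_in_space[OF \<rho>(1)] by (intro path_length_le_add) auto
    also have "\<dots> \<le> ereal x + ereal y" using that by (intro add_mono)
    finally show ?thesis by simp
  qed
  have zero: "path_length \<rho> 0 0 = 0" using path_in_space[OF \<rho>(1), of 0] by simp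
  define t where "t i = [0, t1, t2, t3, t4, t5] ! i" for i :: nat
  have t_simps: "t 0 = 0" "t 1 = t1" "t (Suc 0) = t1" "t 2 = t2" "t (Suc (Suc 0)) = t2" "t 3 = t3" "t 4 = t4" "t 5 = t5"
    by (simp_all add: t_def numeral_eq_Suc)
  have less6: "i = 0 \<or> i = 1 \<or> i = 2 \<or> i = 3 \<or> i = 4 \<or> i = 5" if "i < 6" for i :: nat
    using that by linarith
  have t01: "0 \<le> t i \<and> t i \<le> 1" if "i < 6" for i
    using less6[OF that] t1 t2 t3 t4 t5 by (auto simp: t_simps)
  have in_space: "\<rho> (t i) \<in> graph_points H" if "i < 6" for i
    using t01[OF that] path_in_space[OF \<rho>(1)] by blast
  have dist_le: "graph_dist H (\<rho> p) (\<rho> q) \<le> x" if "p \<le> q" "path_length \<rho> p q \<le> ereal x" for p q x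
    using order_trans[OF dist_le_path_length[OF that(1), of \<rho>] that(2)] by simp
  \<comment> \<open>For \<open>i = 5\<close> the index wraps to 0 while the arc ends at parameter 1;
    there \<open>\<rho> 0 = \<rho> 1\<close> closes the hexagon.\<close>
  have side: "graph_dist H (\<rho> (t i)) (\<rho> (t (Suc i mod 6))) \<le> s" if "i < 6" for i
    using less6[OF that] dist_le[of 0 t1 s] dist_le[of t1 t2 s] dist_le[of t2 t3 s] dist_le[of t3 t4 s]
      dist_le[of t4 t5 s] dist_le[of t5 1 s] t1 t2 t3 t4 t5 \<rho>(2)
    by (elim disjE) (simp_all add: t_simps)
  have "\<exists>v \<gamma> c. v \<in> verts H \<and> unit_speed \<gamma> c \<and> c \<le> 1 \<and> \<gamma> 0 = \<rho> (t i) \<and> \<gamma> c = Vertex v" if "i < 6" for i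
    using unit_speed_to_vertex[OF in_space[OF that]] by metis
  then obtain v \<gamma> c where v: "\<And>i. i < 6 \<Longrightarrow> v i \<in> verts H" and
    \<gamma>: "\<And>i. i < 6 \<Longrightarrow> unit_speed (\<gamma> i) (c i)" "\<And>i. i < 6 \<Longrightarrow> c i \<le> 1"
      "\<And>i. i < 6 \<Longrightarrow> \<gamma> i 0 = \<rho> (t i)" "\<And>i. i < 6 \<Longrightarrow> \<gamma> i (c i) = Vertex (v i)" by metis
  have vertex_side: "real (vertex_dist H (v i) (v (Suc i mod 6))) \<le> s + 2" if "i < 6" for i
  proof -
    have i': "Suc i mod 6 < 6" by simp
    show ?thesis
      using vertex_dist_le_graph_dist[OF in_space[OF that] in_space[OF i'] \<gamma>[OF that] \<gamma>[OF i']] side[OF that]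
      by linarith
  qed
  obtain j
    where j: "j < 3" "3 * real (vertex_dist H (v j) (v (j + 3))) \<le> 7 * (s + 2)"
    using hexagon[of v "s + 2"] v vertex_side by blast
  let ?n = "real (vertex_dist H (v j) (v (j + 3)))"
  have j6: "j < 6" "j + 3 < 6" using j by auto
  obtain \<delta> where \<delta>: "unit_speed \<delta> ?n" "\<delta> 0 = Vertex (v j)" "\<delta> ?n = Vertex (v (j + 3))"
    using unit_speed_vertex_dist[OF v[OF j6(1)] v[OF j6(2)]] by blast
  \<comment> \<open>The shortcut goes from a division point to its vertex, along a geodesic to the
    vertex of the opposite point, and from there to that point.\<close>
  note join1 = unit_speed_join[OF \<gamma>(1)[OF j6(1)] \<delta>(1)]
  note join2 = unit_speed_join[OF join1 unit_speed_reverse[OF \<gamma>(1)[OF j6(2)]]]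
  have "\<exists>\<epsilon> e. unit_speed \<epsilon> e \<and> \<epsilon> 0 = \<rho> (t j) \<and> \<epsilon> e = \<rho> (t (j + 3)) \<and> e \<le> 5 / 2 * s"
  proof (intro exI conjI)
    have nonneg: "0 \<le> c j" "0 \<le> c (j + 3)" using unit_speed_nonneg[OF \<gamma>(1)] j6 by auto
    have eq1: "\<gamma> j (c j) = \<delta> 0" using \<gamma>(4)[OF j6(1)] \<delta>(2) by simp
    \<comment> \<open>If the geodesic is constant, the joined curve takes its end value from the
      branch of \<open>\<gamma> j\<close>.\<close>
    have "?n = 0 \<Longrightarrow> \<gamma> j (c j) = \<delta> ?n" using eq1 by simp
    then have eq2: "(if c j + ?n \<le> c j then \<gamma> j (c j + ?n) else \<delta> (c j + ?n - c j)) =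
        \<gamma> (j + 3) (c (j + 3) - 0)"
      using \<gamma>(4)[OF j6(2)] \<delta>(3) by auto
    show "unit_speed (\<lambda>s. if s \<le> c j + ?n then if s \<le> c j then \<gamma> j s else \<delta> (s - c j)
        else \<gamma> (j + 3) (c (j + 3) - (s - (c j + ?n)))) (c j + ?n + c (j + 3))"
      by (rule join2[OF eq1 eq2])
    have "?n \<le> 7 / 3 * s + 14 / 3" using j(2) by simp
    then have "c j + ?n + c (j + 3) \<le> 7 / 3 * s + 20 / 3" using \<gamma>(2)[OF j6(1)] \<gamma>(2)[OF j6(2)] by simp
    also have "\<dots> \<le> 5 / 2 * s" using s(1) by simp
    finally show "c j + ?n + c (j + 3) \<le> 5 / 2 * s" .
    show "(if 0 \<le> c j + ?n then if 0 \<le> c j then \<gamma> j 0 else \<delta> (0 - c j)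
        else \<gamma> (j + 3) (c (j + 3) - (0 - (c j + ?n)))) = \<rho> (t j)"
      using nonneg \<gamma>(3)[OF j6(1)] by simp
    show "(if c j + ?n + c (j + 3) \<le> c j + ?n
        then if c j + ?n + c (j + 3) \<le> c j then \<gamma> j (c j + ?n + c (j + 3)) else \<delta> (c j + ?n + c (j + 3) - c j)
        else \<gamma> (j + 3) (c (j + 3) - (c j + ?n + c (j + 3) - (c j + ?n)))) = \<rho> (t (j + 3))"
    proof (cases "c (j + 3) = 0")
      case True
      then show ?thesis using eq2 \<gamma>(3)[OF j6(2)] by (auto split: if_splits)
    next
      case False
      then show ?thesis using nonneg \<gamma>(3)[OF j6(2)] by simp
    qed
  qed
  then obtain \<epsilon> e where \<epsilon>: "unit_speed \<epsilon> e" "\<epsilon> 0 = \<rho> (t j)" "\<epsilon> e = \<rho> (t (j + 3))" "e \<le> 5 / 2 * s" by blast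
  define \<mu> where "\<mu> x = \<epsilon> (e * x)" for x
  have \<mu>: "pathin mtopology \<mu>" "\<mu> 0 = \<rho> (t j)" "\<mu> 1 = \<rho> (t (j + 3))"
    using pathin_unit_speed[OF \<epsilon>(1)] \<epsilon>(2,3) by (simp_all add: \<mu>_def[abs_def])
  have "path_length \<mu> 0 1 \<le> ereal e"
    using path_length_unit_speed[OF \<epsilon>(1), of 0 1] by (simp add: \<mu>_def[abs_def])
  also have "\<dots> \<le> ereal (5 / 2 * s)" using \<epsilon>(4) by simp
  finally have \<mu>_length: "path_length \<mu> 0 1 \<le> ereal (5 / 2 * s)" .
  have inner: "path_length \<rho> (t j) (t (j + 3)) \<le> ereal (3 * s) \<and>
      path_length \<rho> (t (j + 3)) 1 + path_length \<rho> 0 (t j) \<le> ereal (3 * s)"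
  proof -
    consider "j = 0" | "j = 1" | "j = 2" using j(1) by linarith
    then show ?thesis
    proof cases
      case 1
      then show ?thesis using t3 zero by (simp add: t_simps)
    next
      case 2
      have "path_length \<rho> t1 t4 \<le> ereal (2 * s + s)"
        using add[of t1 t3 t4 "2 * s" s] t1 t3 t4 by simp
      moreover have "path_length \<rho> t4 1 + path_length \<rho> 0 t1 \<le> ereal (2 * s) + ereal s"
        using t1 t4 by (intro add_mono)
      ultimately show ?thesis using 2 by (simp add: t_simps)
    next
      case 3
      have "path_length \<rho> t3 t5 \<le> ereal (s + s)"
        using add[of t3 t4 t5 s s] t3 t4 t5 by simp
      then have "path_length \<rho> t2 t5 \<le> ereal (s + (s + s))"
        using t1 t2 t3 t4 t5 by (intro add[of t2 t3 t5]) auto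
      moreover have "path_length \<rho> 0 t2 \<le> ereal (s + s)"
        using t1 t2 t3 by (intro add[of 0 t1 t2]) auto
      then have "path_length \<rho> t5 1 + path_length \<rho> 0 t2 \<le> ereal s + ereal (s + s)"
        using t5 by (intro add_mono)
      ultimately show ?thesis using 3 by (simp add: t_simps)
    qed
  qed
  have tj: "0 \<le> t j" "t j \<le> t (j + 3)" "t (j + 3) \<le> 1"
  proof -
    have "j = 0 \<or> j = 1 \<or> j = 2" using j(1) by linarith
    then show "0 \<le> t j" "t j \<le> t (j + 3)" "t (j + 3) \<le> 1"
      using t1 t2 t3 t4 t5 by (auto simp: t_simps)
  qed
  have bound: "x + path_length \<mu> 0 1 \<le> ereal (11 / 12) * path_length \<rho> 0 1" if "x \<le> ereal (3 * s)" for x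
  proof -
    have "x + path_length \<mu> 0 1 \<le> ereal (3 * s) + ereal (5 / 2 * s)"
      using that \<mu>_length by (rule add_mono)
    also have "\<dots> = ereal (11 / 12) * path_length \<rho> 0 1" using s(2) l by simp
    finally show ?thesis .
  qed
  show "\<exists>p q \<mu>. 0 \<le> p \<and> p \<le> q \<and> q \<le> 1 \<and> pathin mtopology \<mu> \<and> \<mu> 0 = \<rho> p \<and> \<mu> 1 = \<rho> q \<and>
      path_length \<rho> p q + path_length \<mu> 0 1 \<le> ereal (11 / 12) * path_length \<rho> 0 1 \<and>
      path_length \<rho> q 1 + path_length \<rho> 0 p + path_length \<mu> 0 1 \<le> ereal (11 / 12) * path_length \<rho> 0 1"
    using tj \<mu> bound inner by blast
qed

text \<open>A defect \<open>c\<close> that stays bounded as \<open>h\<close> grows makes the ratio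
  of antipodal distance to half-length tend to 1, so a shortcut factor below 1 eventually
  contradicts \<open>subdivision_antipodal\<close>.\<close>

theorem not_strongly_shortcut_antipodal:
  fixes c :: nat
  assumes loops: "\<And>n. \<exists>h g. n \<le> h \<and> g 0 \<in> verts H \<and> g (2 * h) = g 0 \<and>
      (\<forall>k<2 * h. (g k, g (Suc k)) \<in> adjacency H) \<and> (\<forall>k<h. h \<le> vertex_dist H (g k) (g (k + h)) + c)"
  shows "\<not> strongly_shortcut"
proof
  assume strongly_shortcut
  then obtain L \<kappa> where L: "0 \<le> L" "\<kappa> < 1" and shortcut: "\<And>\<rho>. loop_in \<rho> \<Longrightarrow> ereal L \<le> path_length \<rho> 0 1 \<Longrightarrow>
      path_length \<rho> 0 1 < \<infinity> \<Longrightarrow> (\<exists>p q \<mu>. 0 \<le> p \<and> p \<le> q \<and> q \<le> 1 \<and>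
             pathin mtopology \<mu> \<and> \<mu> 0 = \<rho> p \<and> \<mu> 1 = \<rho> q \<and>
             path_length \<rho> p q + path_length \<mu> 0 1 \<le> ereal \<kappa> * path_length \<rho> 0 1 \<and>
             path_length \<rho> q 1 + path_length \<rho> 0 p + path_length \<mu> 0 1 \<le> ereal \<kappa> * path_length \<rho> 0 1)"
    unfolding strongly_shortcut_def by blast
  \<comment> \<open>A negative factor would reverse the comparison of \<open>\<kappa> * l\<close>
    with \<open>\<kappa> * (2 * real h)\<close>.\<close>
  define \<kappa>' where "\<kappa>' = max \<kappa> 0"
  have \<kappa>': "\<kappa> \<le> \<kappa>'" "0 \<le> \<kappa>'" "\<kappa>' < 1" using L by (auto simp: \<kappa>'_def)
  \<comment> \<open>The quotient yields \<open>\<kappa>' * h \<le> h - c - 3\<close>, strictly below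
    \<open>E\<close>; the other summands yield \<open>L \<le> E\<close>, so the loop is long enough
    to be subject to the shortcut condition.\<close>
  obtain n where n: "(real c + 3) / (1 - \<kappa>') + L + real c + 2 \<le> real n" using real_arch_simple by blast
  obtain h and g :: "nat \<Rightarrow> 'v" where h: "n \<le> h" and g: "g 0 \<in> verts H" "g (2 * h) = g 0"
      "\<And>k. k < 2 * h \<Longrightarrow> (g k, g (Suc k)) \<in> adjacency H"
      "\<And>k. k < h \<Longrightarrow> h \<le> vertex_dist H (g k) (g (k + h)) + c"
    using loops[of n] by blast
  \<comment> \<open>The 2 pays for rounding both ends of a half turn down to vertices of the
    edge-path.\<close>
  define E where "E = real h - real c - 2"
  have "0 \<le> (real c + 3) / (1 - \<kappa>')" using \<kappa>' by simp
  then have hE: "L \<le> E" "(real c + 3) / (1 - \<kappa>') \<le> real h" "0 < h"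
    using n h L unfolding E_def by linarith+
  have "real c + 3 \<le> real h * (1 - \<kappa>')" using hE(2) \<kappa>' by (simp add: divide_le_eq)
  then have E: "\<kappa>' * (2 * real h) < 2 * E" by (simp add: E_def algebra_simps)
  obtain \<gamma> where \<gamma>: "unit_speed \<gamma> (real (2 * h))" "\<And>k. k \<le> 2 * h \<Longrightarrow> \<gamma> (real k) = Vertex (g k)"
    using unit_speed_walk[of g "2 * h"] g by blast
  have gV: "g k \<in> verts H" if "k \<le> 2 * h" for k
    using unit_speed_in_space[OF \<gamma>(1), of "real k"] \<gamma>(2)[OF that] that by simp
  \<comment> \<open>The value \<open>k = h\<close> arises from \<open>s = 1 / 2\<close>; it is the
    pair of \<open>k = 0\<close> with its ends exchanged.\<close>
  have far_vertices: "real h \<le> vertex_dist H (g k) (g (k + h)) + real c" if "k \<le> h" for k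
  proof (cases "k = h")
    case True
    then have "vertex_dist H (g k) (g (k + h)) = vertex_dist H (g 0) (g (0 + h))"
      using g(2) vertex_dist_commute[of H] by (simp add: mult_2)
    then show ?thesis using g(4)[of 0] \<open>0 < h\<close> by simp
  next
    case False
    then show ?thesis using g(4)[of k] that by linarith
  qed
  define \<rho> where "\<rho> s = \<gamma> (real (2 * h) * s)" for s
  have in_space: "\<rho> s \<in> graph_points H" if "0 \<le> s" "s \<le> 1" for s
    unfolding \<rho>_def by (rule unit_speed_rescaled_in_space[OF \<gamma>(1)]) (use that in auto)
  have far: "E \<le> graph_dist H (\<rho> s) (\<rho> (s + 1 / 2))" if s: "0 \<le> s" "s \<le> 1 / 2" for s
  proof -
    define x where "x = real (2 * h) * s"
    define k where "k = nat \<lfloor>x\<rfloor>"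
    have "0 \<le> x" using s by (simp add: x_def)
    then have k: "real k \<le> x" "x \<le> real k + 1" unfolding k_def by linarith+
    have "x \<le> real h" using mult_left_mono[OF s(2), of "real (2 * h)"] by (simp add: x_def)
    with k have "k \<le> h" by linarith
    have \<rho>: "\<rho> s = \<gamma> x" "\<rho> (s + 1 / 2) = \<gamma> (x + real h)"
      by (simp_all add: \<rho>_def x_def algebra_simps)
    have V: "\<gamma> (real k) = Vertex (g k)" "\<gamma> (real k + real h) = Vertex (g (k + h))"
      "g k \<in> verts H" "g (k + h) \<in> verts H"
      using \<gamma>(2)[of k] \<gamma>(2)[of "k + h"] \<open>k \<le> h\<close> gV[of k] gV[of "k + h"] by simp_all
    have "graph_dist H (\<gamma> (real k)) (\<gamma> x) \<le> 1"
      using unit_speed_dist[OF \<gamma>(1), of "real k" x] k \<open>x \<le> real h\<close> by simp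
    moreover have "graph_dist H (\<gamma> (x + real h)) (\<gamma> (real k + real h)) \<le> 1"
      using unit_speed_dist[OF \<gamma>(1), of "x + real h" "real k + real h"] k \<open>x \<le> real h\<close> by simp
    moreover have "\<gamma> x \<in> graph_points H" "\<gamma> (x + real h) \<in> graph_points H"
      using in_space[of s] in_space[of "s + 1 / 2"] s \<rho> by simp_all
    then have "graph_dist H (Vertex (g k)) (Vertex (g (k + h))) \<le>
        graph_dist H (Vertex (g k)) (\<gamma> x) + graph_dist H (\<gamma> x) (\<gamma> (x + real h)) +
        graph_dist H (\<gamma> (x + real h)) (Vertex (g (k + h)))"
      using triangle[of "Vertex (g k)" "\<gamma> x" "Vertex (g (k + h))"]
        triangle[of "\<gamma> x" "\<gamma> (x + real h)" "Vertex (g (k + h))"] V(3,4) by simp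
    ultimately show ?thesis
      using far_vertices[OF \<open>k \<le> h\<close>] graph_dist_Vertex[OF V(3,4)] V(1,2) \<rho> by (simp add: E_def)
  qed
  have closed: "\<rho> 0 = \<rho> 1" using \<gamma>(2)[of 0] \<gamma>(2)[of "2 * h"] g(2) by (simp add: \<rho>_def)
  have "path_length \<rho> 0 1 \<le> ereal (2 * real h)"
    using path_length_unit_speed[OF \<gamma>(1), of 0 1] by (simp add: \<rho>_def[abs_def])
  moreover have "ereal (2 * E) \<le> path_length \<rho> 0 1"
  proof (rule order_trans[OF _ dist2_le_path_length[of 0 "1 / 2"]])
    show "ereal (2 * E) \<le> ereal (graph_dist H (\<rho> 0) (\<rho> (1 / 2)) + graph_dist H (\<rho> (1 / 2)) (\<rho> 1))"
      using far[of 0] far[of "1 / 2"] by simp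
  qed auto
  ultimately obtain l where l: "path_length \<rho> 0 1 = ereal l" "2 * E \<le> l" "l \<le> 2 * real h"
    by (cases "path_length \<rho> 0 1") auto
  have "loop_in \<rho>"
    using pathin_unit_speed[OF \<gamma>(1)] closed by (simp add: loop_in_def \<rho>_def[abs_def])
  moreover have "ereal L \<le> path_length \<rho> 0 1" using l L hE(1) by simp
  ultimately obtain p q \<mu> where pq: "0 \<le> p" "p \<le> q" "q \<le> 1" "\<mu> 0 = \<rho> p" "\<mu> 1 = \<rho> q"
      "path_length \<rho> p q + path_length \<mu> 0 1 \<le> ereal (\<kappa> * l)"
      "path_length \<rho> q 1 + path_length \<rho> 0 p + path_length \<mu> 0 1 \<le> ereal (\<kappa> * l)"
    using shortcut[of \<rho>] l(1) by auto
  have "2 * E \<le> \<kappa> * l"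
    by (rule subdivision_antipodal[of p q \<rho> \<mu>, OF pq(1-3) in_space closed pq(4,5) far pq(6,7)])
  also have "\<dots> \<le> \<kappa>' * (2 * real h)"
    using l \<kappa>' L hE(1) by (intro mult_mono) auto
  finally show False using E by simp
qed

end

section \<open>Tree metrics\<close>

abbreviation lcp :: "'a list \<Rightarrow> 'a list \<Rightarrow> nat" where
  "lcp u v \<equiv> length (longest_common_prefix u v)"

lemma lcp_commute: "lcp u v = lcp v u"
  by (induction u v rule: longest_common_prefix.induct) auto

lemma lcp_le: "lcp u v \<le> length u" "lcp u v \<le> length v"
  by (simp_all add: prefix_length_le longest_common_prefix_prefix1 longest_common_prefix_prefix2)

text \<open>On the shorter of the two prefixes that they share with \<open>v\<close>, the words
  \<open>u\<close> and \<open>w\<close> agree with each other.\<close>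

lemma lcp_ultrametric: "min (lcp u v) (lcp v w) \<le> lcp u w"
proof (induction u arbitrary: v w)
  case (Cons x u)
  show ?case
  proof (cases v)
    case v: (Cons y v')
    then show ?thesis using Cons[of v'] by (cases w) auto
  qed simp
qed simp

lemma lcp_append: "lcp u (u @ v) = length u"
  by (induction u) simp_all

text \<open>
  The distance between two reduced words in the Cayley tree of a free group: the path between them
  passes through their longest common prefix.
\<close>

definition tree_dist :: "'a list \<Rightarrow> 'a list \<Rightarrow> real" where
  "tree_dist u v = real (length u) + real (length v) - 2 * real (lcp u v)"

lemma tree_dist_nonneg: "0 \<le> tree_dist u v"
  using lcp_le[of u v] by (simp add: tree_dist_def)

lemma tree_dist_commute: "tree_dist u v = tree_dist v u"
  by (simp add: tree_dist_def lcp_commute)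

lemma tree_dist_self [simp]: "tree_dist u u = 0"
  using lcp_append[of u "[]"] by (simp add: tree_dist_def)

lemma tree_dist_append: "tree_dist u (u @ v) = length v"
  by (simp add: tree_dist_def lcp_append)

lemma tree_dist_triangle: "tree_dist u w \<le> tree_dist u v + tree_dist v w"
  using lcp_ultrametric[of u v w] lcp_le[of u v] lcp_le[of v w] by (simp add: tree_dist_def)

text \<open>\<open>lcp\<close> is the Gromov product based at the empty word, and its ultrametric
  inequality is the 0-hyperbolic form of the four-point condition.\<close>

lemma tree_dist_four_point:
  "tree_dist u v + tree_dist w x \<le> max (tree_dist u w + tree_dist v x) (tree_dist u x + tree_dist v w)"
  using lcp_ultrametric[of u w v] lcp_ultrametric[of u x v] lcp_ultrametric[of w u x]
    lcp_ultrametric[of w v x] lcp_commute[of w u] lcp_commute[of w v] lcp_commute[of x v]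
    lcp_commute[of x u]
  by (simp add: tree_dist_def)

text \<open>Here \<open>e j\<close> is the combined length of two opposite sides. The four-point
  condition, applied to two diagonals at a time, bounds their sum by the maximum of one
  \<open>e j\<close> and the sum of the other two. Adding the three bounds gives twice the sum of
  the \<open>e j\<close> if no \<open>e j\<close> dominates; if one exceeds the sum of the others,
  it gives the sum plus twice that one.\<close>

lemma tree_hexagon:
  fixes v :: "nat \<Rightarrow> 'a list"
  defines "e \<equiv> \<lambda>j. tree_dist (v j) (v (Suc j mod 6)) + tree_dist (v (j + 3)) (v (Suc (j + 3) mod 6))"
  shows "2 * (\<Sum>j<3. tree_dist (v j) (v (j + 3))) \<le>
    (\<Sum>j<3. e j) + max (\<Sum>j<3. e j) (2 * max (e 0) (max (e 1) (e 2)))"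
proof -
  let ?d = "\<lambda>i j. tree_dist (v i) (v j)"
  have tri: "?d i k \<le> ?d i j + ?d j k" for i j k by (rule tree_dist_triangle)
  have four: "?d 0 3 + ?d 1 4 \<le> max (?d 0 1 + ?d 3 4) (?d 0 4 + ?d 3 1)"
    "?d 0 3 + ?d 2 5 \<le> max (?d 0 2 + ?d 3 5) (?d 0 5 + ?d 3 2)"
    "?d 1 4 + ?d 2 5 \<le> max (?d 1 2 + ?d 4 5) (?d 1 5 + ?d 4 2)"
    by (rule tree_dist_four_point)+
  have comm: "?d i j = ?d j i" for i j by (rule tree_dist_commute)
  have tris: "?d 0 4 \<le> ?d 4 5 + ?d 5 0" "?d 3 1 \<le> ?d 1 2 + ?d 2 3" "?d 0 2 \<le> ?d 0 1 + ?d 1 2"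
    "?d 3 5 \<le> ?d 3 4 + ?d 4 5" "?d 1 5 \<le> ?d 5 0 + ?d 0 1" "?d 4 2 \<le> ?d 2 3 + ?d 3 4"
    "?d 0 5 = ?d 5 0" "?d 3 2 = ?d 2 3"
    using tri[of 0 4 5] tri[of 3 1 2] tri[of 0 2 1] tri[of 3 5 4] tri[of 1 5 0] tri[of 4 2 3]
      comm[of 0 5] comm[of 4 5] comm[of 3 2] comm[of 1 2] comm[of 1 0] comm[of 4 3] by linarith+
  have e: "e 0 = ?d 0 1 + ?d 3 4" "e 1 = ?d 1 2 + ?d 4 5" "e 2 = ?d 2 3 + ?d 5 0"
    unfolding e_def Suc_eq_plus1 by (simp_all del: One_nat_def)
  have sums: "(\<Sum>j<3. e j) = e 0 + e 1 + e 2" "(\<Sum>j<3. ?d j (j + 3)) = ?d 0 3 + ?d 1 4 + ?d 2 5"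
    by (simp_all add: numeral_3_eq_3 eval_nat_numeral)
  have pairs: "?d 0 3 + ?d 1 4 \<le> max (e 0) (e 1 + e 2)" "?d 0 3 + ?d 2 5 \<le> max (e 2) (e 0 + e 1)"
    "?d 1 4 + ?d 2 5 \<le> max (e 1) (e 0 + e 2)"
    using four tris unfolding e by linarith+
  have "0 \<le> e 0" "0 \<le> e 1" "0 \<le> e 2" unfolding e_def by (simp_all add: tree_dist_nonneg)
  with pairs show ?thesis unfolding sums by (smt (verit))
qed

text \<open>The side bounds give \<open>e j + f j \<le> 2 * r\<close>, so the plain sums contribute
  at most \<open>6 * r\<close>. The two maxima contribute at most \<open>8 * r\<close>, attained
  when one tree carries one pair of opposite sides and the other tree another pair. Hence the three
  diagonals sum to at most \<open>7 * r\<close>, and the least of them is at most a third of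
  this.\<close>

lemma two_tree_hexagon:
  fixes v :: "nat \<Rightarrow> 'a list" and w :: "nat \<Rightarrow> 'b list"
  assumes side: "\<And>i. i < 6 \<Longrightarrow> tree_dist (v i) (v (Suc i mod 6)) + tree_dist (w i) (w (Suc i mod 6)) \<le> r"
  shows "\<exists>j<3. 3 * (tree_dist (v j) (v (j + 3)) + tree_dist (w j) (w (j + 3))) \<le> 7 * r"
proof (rule ccontr)
  define e where "e j = tree_dist (v j) (v (Suc j mod 6)) + tree_dist (v (j + 3)) (v (Suc (j + 3) mod 6))" for j
  define f where "f j = tree_dist (w j) (w (Suc j mod 6)) + tree_dist (w (j + 3)) (w (Suc (j + 3) mod 6))" for j
  assume "\<not> ?thesis"
  then have far: "7 * r < 3 * (tree_dist (v j) (v (j + 3)) + tree_dist (w j) (w (j + 3)))" if "j < 3" for j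
    using that by auto
  have nonneg: "0 \<le> e j" "0 \<le> f j" for j by (simp_all add: e_def f_def tree_dist_nonneg)
  have ef: "e j + f j \<le> 2 * r" if "j < 3" for j
    using side[of j] side[of "j + 3"] that by (simp add: e_def f_def)
  have sum3: "(\<Sum>j<3. g j) = g 0 + g 1 + g 2" for g :: "nat \<Rightarrow> real"
    by (simp add: numeral_3_eq_3 eval_nat_numeral)
  have "2 * (\<Sum>j<3. tree_dist (v j) (v (j + 3))) \<le> (\<Sum>j<3. e j) + max (\<Sum>j<3. e j) (2 * max (e 0) (max (e 1) (e 2)))"
    "2 * (\<Sum>j<3. tree_dist (w j) (w (j + 3))) \<le> (\<Sum>j<3. f j) + max (\<Sum>j<3. f j) (2 * max (f 0) (max (f 1) (f 2)))"
    unfolding e_def f_def by (rule tree_hexagon)+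
  then show False
    using far[of 0] far[of 1] far[of 2] ef[of 0] ef[of 1] ef[of 2] nonneg[of 0] nonneg[of 1] nonneg[of 2]
    unfolding sum3 by simp
qed

section \<open>Right multiplication by a letter in a free group\<close>

lemma reduced_append:
  "reduced (u @ v) \<longleftrightarrow> reduced u \<and> reduced v \<and> (u = [] \<or> v = [] \<or> hd v \<noteq> inv_letter (last u))"
  by (auto simp: reduced_def successively_append_iff)

lemma reduced_replicate: "reduced (replicate n l)"
  by (induction n) (auto simp: reduced_Cons inv_letter_neq[THEN not_sym])

lemma mult_letter_snoc:
  "reduced (u @ [l]) \<Longrightarrow> foldr reduced_cons u [l] = u @ [l]"
  using foldr_reduced_cons_Nil[of "u @ [l]"] by simp

lemma mult_letter_cancel:
  "reduced u \<Longrightarrow> foldr reduced_cons (u @ [inv_letter l]) [l] = u"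
  by (simp add: foldr_reduced_cons_Nil)

text \<open>Right multiplication by a letter is a step in the Cayley tree, either away from the root
  or towards it.\<close>

lemma mult_letter_cases:
  assumes "reduced u"
  obtains (snoc) "foldr reduced_cons u [l] = u @ [l]" "reduced (u @ [l])"
    | (cancel) w where "u = w @ [inv_letter l]" "foldr reduced_cons u [l] = w" "reduced w"
proof (cases "u \<noteq> [] \<and> last u = inv_letter l")
  case True
  then have u: "u = butlast u @ [inv_letter l]" by (metis append_butlast_last_id)
  with assms have "reduced (butlast u)" by (metis reduced_append)
  with u show ?thesis using cancel[of "butlast u"] mult_letter_cancel[of "butlast u" l] by metis
next
  case False
  then have "reduced (u @ [l])"
    using assms by (auto simp: reduced_append reduced_Cons)
  then show ?thesis by (intro snoc mult_letter_snoc)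
qed

lemma tree_dist_mult_letter:
  assumes "reduced u"
  shows "tree_dist u (foldr reduced_cons u [l]) = 1"
  using assms
proof (cases rule: mult_letter_cases[of _ l])
  case snoc
  then show ?thesis by (simp add: tree_dist_append)
next
  case (cancel w)
  then show ?thesis using tree_dist_append[of w "[inv_letter l]"] by (simp add: tree_dist_commute)
qed

section \<open>Cayley graphs of products of two free groups\<close>

lemma adjacency_cayley_graph:
  "(x, y) \<in> adjacency (cayley_graph G A) \<longleftrightarrow>
    (x \<in> carrier G \<and> (\<exists>s\<in>A. y = x \<otimes>\<^bsub>G\<^esub> s)) \<or> (y \<in> carrier G \<and> (\<exists>s\<in>A. x = y \<otimes>\<^bsub>G\<^esub> s))"
  by (auto simp: cayley_graph_def arcs_ends_conv image_iff)

lemma adjacency_cayley_graphI: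
  assumes "x \<in> carrier G" "s \<in> A"
  shows "(x, x \<otimes>\<^bsub>G\<^esub> s) \<in> adjacency (cayley_graph G A)" "(x \<otimes>\<^bsub>G\<^esub> s, x) \<in> adjacency (cayley_graph G A)"
  using assms adjacency_cayley_graph by metis+

lemma wf_digraph_cayley_graph:
  assumes "group G" "A \<subseteq> carrier G"
  shows "wf_digraph (cayley_graph G A)"
proof -
  interpret group G by (fact assms(1))
  show ?thesis using assms(2) by unfold_locales (auto simp: cayley_graph_def)
qed

lemma sym_relpow:
  assumes "sym R" "(x, y) \<in> R ^^ n"
  shows "(y, x) \<in> R ^^ n"
  using assms(2)
proof (induction n arbitrary: y)
  case (Suc n)
  then obtain z where "(x, z) \<in> R ^^ n" "(z, y) \<in> R" by auto
  then show ?case using relpow_Suc_I2[OF symD[OF assms(1)] Suc.IH] by simp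
qed simp

lemma sym_adjacency: "sym (adjacency H)"
  by (auto simp: sym_def)

lemma free_group_carrier: "u \<in> carrier (free_group S) \<longleftrightarrow> fst ` set u \<subseteq> S \<and> reduced u"
  by (simp add: free_group_def)

lemma free_group_mult: "u \<otimes>\<^bsub>free_group S\<^esub> v = foldr reduced_cons u v"
  by (simp add: free_group_def)

lemma free_group_one: "\<one>\<^bsub>free_group S\<^esub> = []"
  by (simp add: free_group_def)

lemma free_group_product_mult:
  "(u, v) \<otimes>\<^bsub>free_group S \<times>\<times> free_group T\<^esub> (u', v') = (foldr reduced_cons u u', foldr reduced_cons v v')"
  by (simp add: DirProd_def free_group_mult)

lemma free_group_product_carrier:
  "(u, v) \<in> carrier (free_group S \<times>\<times> free_group T) \<longleftrightarrow>
    (fst ` set u \<subseteq> S \<and> reduced u) \<and> (fst ` set v \<subseteq> T \<and> reduced v)"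
  by (auto simp: DirProd_def free_group_carrier)

lemma group_free_group_product: "group (free_group S \<times>\<times> free_group T)"
  by (intro DirProd_group group_free_group)

section \<open>Standard generators: the l1 sum of two tree metrics\<close>

definition standard_cayley ::
    "'x set \<Rightarrow> 'y set \<Rightarrow> (('x \<times> bool) list \<times> ('y \<times> bool) list,
      (('x \<times> bool) list \<times> ('y \<times> bool) list) \<times> (('x \<times> bool) list \<times> ('y \<times> bool) list)) pre_digraph" where
  "standard_cayley S T = cayley_graph (free_group S \<times>\<times> free_group T)
     ((\<lambda>x. (free_gen x, [])) ` S \<union> (\<lambda>y. ([], free_gen y)) ` T)"

lemma verts_standard_cayley: "verts (standard_cayley S T) = carrier (free_group S \<times>\<times> free_group T)"
  by (simp add: standard_cayley_def cayley_graph_def)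

text \<open>If the last letter is a generator, the edge starts at the shorter word; if it is an
  inverse, the same tree edge starts at the longer word and cancels its last letter.\<close>

lemma standard_cayley_adjacency_fst:
  assumes "(u @ [l], v) \<in> verts (standard_cayley S T)"
  shows "((u, v), (u @ [l], v)) \<in> adjacency (standard_cayley S T)"
proof -
  obtain x b where l: "l = (x, b)" by (cases l)
  have v: "foldr reduced_cons v [] = v" and u: "reduced u" "reduced (u @ [l])" "x \<in> S"
    using assms l by (auto simp: verts_standard_cayley free_group_product_carrier free_group_carrier foldr_reduced_cons_Nil reduced_append)
  have ends: "(u, v) \<in> carrier (free_group S \<times>\<times> free_group T)"
    "(u @ [l], v) \<in> carrier (free_group S \<times>\<times> free_group T)"
    using assms by (auto simp: verts_standard_cayley free_group_product_carrier free_group_carrier reduced_append)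
  have gen: "(free_gen x, []) \<in> (\<lambda>x. (free_gen x, [])) ` S \<union> (\<lambda>y. ([], free_gen y)) ` T"
    using u(3) by simp
  show ?thesis
  proof (cases b)
    case True
    then have "(u @ [l], v) = (u, v) \<otimes>\<^bsub>free_group S \<times>\<times> free_group T\<^esub> (free_gen x, [])"
      using mult_letter_snoc[OF u(2)] v l by (simp add: free_group_product_mult free_group_mult free_gen_def)
    then show ?thesis
      using adjacency_cayley_graphI(1)[OF ends(1) gen] by (simp add: standard_cayley_def)
  next
    case False
    then have "(u, v) = (u @ [l], v) \<otimes>\<^bsub>free_group S \<times>\<times> free_group T\<^esub> (free_gen x, [])"
      using mult_letter_cancel[OF u(1), of "(x, True)"] v l
      by (simp add: free_group_product_mult free_group_mult free_gen_def inv_letter_def)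
    then show ?thesis
      using adjacency_cayley_graphI(2)[OF ends(2) gen] by (simp add: standard_cayley_def)
  qed
qed

lemma standard_cayley_adjacency_snd:
  assumes "(u, v @ [l]) \<in> verts (standard_cayley S T)"
  shows "((u, v), (u, v @ [l])) \<in> adjacency (standard_cayley S T)"
proof -
  obtain x b where l: "l = (x, b)" by (cases l)
  have u: "foldr reduced_cons u [] = u" and v: "reduced v" "reduced (v @ [l])" "x \<in> T"
    using assms l by (auto simp: verts_standard_cayley free_group_product_carrier free_group_carrier foldr_reduced_cons_Nil reduced_append)
  have ends: "(u, v) \<in> carrier (free_group S \<times>\<times> free_group T)"
    "(u, v @ [l]) \<in> carrier (free_group S \<times>\<times> free_group T)"
    using assms by (auto simp: verts_standard_cayley free_group_product_carrier free_group_carrier reduced_append)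
  have gen: "([], free_gen x) \<in> (\<lambda>x. (free_gen x, [])) ` S \<union> (\<lambda>y. ([], free_gen y)) ` T"
    using v(3) by simp
  show ?thesis
  proof (cases b)
    case True
    then have "(u, v @ [l]) = (u, v) \<otimes>\<^bsub>free_group S \<times>\<times> free_group T\<^esub> ([], free_gen x)"
      using mult_letter_snoc[OF v(2)] u l by (simp add: free_group_product_mult free_group_mult free_gen_def)
    then show ?thesis
      using adjacency_cayley_graphI(1)[OF ends(1) gen] by (simp add: standard_cayley_def)
  next
    case False
    then have "(u, v) = (u, v @ [l]) \<otimes>\<^bsub>free_group S \<times>\<times> free_group T\<^esub> ([], free_gen x)"
      using mult_letter_cancel[OF v(1), of "(x, True)"] u l
      by (simp add: free_group_product_mult free_group_mult free_gen_def inv_letter_def)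
    then show ?thesis
      using adjacency_cayley_graphI(2)[OF ends(2) gen] by (simp add: standard_cayley_def)
  qed
qed

lemma standard_cayley_prefix_fst:
  assumes "(p @ w, v) \<in> verts (standard_cayley S T)"
  shows "((p, v), (p @ w, v)) \<in> adjacency (standard_cayley S T) ^^ length w"
  using assms
proof (induction w rule: rev_induct)
  case (snoc l w)
  then have "(p @ w, v) \<in> verts (standard_cayley S T)"
    by (auto simp: verts_standard_cayley free_group_product_carrier free_group_carrier reduced_append)
  then show ?case
    using snoc standard_cayley_adjacency_fst[of "p @ w" l v S T] by (auto intro: relcompI)
qed simp

lemma standard_cayley_prefix_snd:
  assumes "(u, p @ w) \<in> verts (standard_cayley S T)"
  shows "((u, p), (u, p @ w)) \<in> adjacency (standard_cayley S T) ^^ length w"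
  using assms
proof (induction w rule: rev_induct)
  case (snoc l w)
  then have "(u, p @ w) \<in> verts (standard_cayley S T)"
    by (auto simp: verts_standard_cayley free_group_product_carrier free_group_carrier reduced_append)
  then show ?case
    using snoc standard_cayley_adjacency_snd[of u "p @ w" l S T] by (auto intro: relcompI)
qed simp

lemma longest_common_prefix_split:
  obtains p w w' where "u = p @ w" "u' = p @ w'" "tree_dist u u' = real (length w + length w')"
proof -
  obtain w w' where "u = longest_common_prefix u u' @ w" "u' = longest_common_prefix u u' @ w'"
    using longest_common_prefix_prefix1 longest_common_prefix_prefix2 by (metis prefixE)
  moreover from this have "length u = lcp u u' + length w" "length u' = lcp u u' + length w'"
    by (metis length_append)+
  ultimately show thesis using that by (simp add: tree_dist_def)
qed

text \<open>The coordinates move one after the other, each descending to the common prefix and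
  climbing from there.\<close>

lemma standard_cayley_walk:
  assumes "(u, v) \<in> verts (standard_cayley S T)" "(u', v') \<in> verts (standard_cayley S T)"
  obtains n where "((u, v), (u', v')) \<in> adjacency (standard_cayley S T) ^^ n"
    "real n = tree_dist u u' + tree_dist v v'"
proof -
  let ?R = "adjacency (standard_cayley S T)"
  obtain p w w' where u: "u = p @ w" "u' = p @ w'" "tree_dist u u' = real (length w + length w')"
    by (rule longest_common_prefix_split)
  obtain q z z' where v: "v = q @ z" "v' = q @ z'" "tree_dist v v' = real (length z + length z')"
    by (rule longest_common_prefix_split)
  have *: "(u', v) \<in> verts (standard_cayley S T)"
    using assms by (auto simp: verts_standard_cayley free_group_product_carrier free_group_carrier)
  have "((u, v), (p, v)) \<in> ?R ^^ length w"
    using sym_relpow[OF sym_adjacency standard_cayley_prefix_fst] assms(1) u by blast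
  moreover have "((p, v), (u', v)) \<in> ?R ^^ length w'"
    using standard_cayley_prefix_fst * u by blast
  moreover have "((u', v), (u', q)) \<in> ?R ^^ length z"
    using sym_relpow[OF sym_adjacency standard_cayley_prefix_snd] * v by blast
  moreover have "((u', q), (u', v')) \<in> ?R ^^ length z'"
    using standard_cayley_prefix_snd assms(2) v by blast
  ultimately have "((u, v), (u', v')) \<in> ?R ^^ (length w + length w' + length z + length z')"
    unfolding relpow_add by blast
  then show thesis using that u(3) v(3) by simp
qed

text \<open>A generator changes one coordinate only, and there crosses one tree edge. With the
  triangle inequality this bounds the length of every walk from below.\<close>

lemma standard_cayley_step:
  assumes "((u, v), (u', v')) \<in> adjacency (standard_cayley S T)"
  shows "tree_dist u u' + tree_dist v v' = 1"
proof -
  have *: "tree_dist u u' + tree_dist v v' = 1"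
    if "(u, v) \<in> carrier (free_group S \<times>\<times> free_group T)"
      "s \<in> (\<lambda>x. (free_gen x, [])) ` S \<union> (\<lambda>y. ([], free_gen y)) ` T"
      "(u', v') = (u, v) \<otimes>\<^bsub>free_group S \<times>\<times> free_group T\<^esub> s" for u v u' v' s
    using that
    by (auto simp: tree_dist_mult_letter free_group_product_carrier free_group_carrier free_group_product_mult free_group_mult foldr_reduced_cons_Nil free_gen_def)
  from assms show ?thesis
    unfolding standard_cayley_def adjacency_cayley_graph
    using *[of u v _ u' v'] *[of u' v' _ u v] tree_dist_commute[of u u'] tree_dist_commute[of v v']
    by metis
qed

lemma standard_cayley_walk_length:
  "((u, v), (u', v')) \<in> adjacency (standard_cayley S T) ^^ n \<Longrightarrow> tree_dist u u' + tree_dist v v' \<le> real n"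
proof (induction n arbitrary: u' v')
  case (Suc n)
  then obtain u'' v'' where "((u, v), (u'', v'')) \<in> adjacency (standard_cayley S T) ^^ n"
      "((u'', v''), (u', v')) \<in> adjacency (standard_cayley S T)" by auto
  then have "tree_dist u u'' + tree_dist v v'' \<le> real n" "tree_dist u'' u' + tree_dist v'' v' = 1"
    using Suc.IH standard_cayley_step by blast+
  then show ?case
    using tree_dist_triangle[of u u' u''] tree_dist_triangle[of v v' v''] by simp
qed simp

lemma standard_cayley_connected:
  assumes "x \<in> verts (standard_cayley S T)" "y \<in> verts (standard_cayley S T)"
  shows "(x, y) \<in> (adjacency (standard_cayley S T))\<^sup>*"
  using assms standard_cayley_walk[of "fst x" "snd x" S T "fst y" "snd y"] relpow_imp_rtrancl
  by (metis prod.collapse)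

lemma vertex_dist_standard_cayley:
  assumes "(u, v) \<in> verts (standard_cayley S T)" "(u', v') \<in> verts (standard_cayley S T)"
  shows "real (vertex_dist (standard_cayley S T) (u, v) (u', v')) = tree_dist u u' + tree_dist v v'"
proof (rule antisym)
  obtain n where "((u, v), (u', v')) \<in> adjacency (standard_cayley S T) ^^ n"
    "real n = tree_dist u u' + tree_dist v v'"
    using standard_cayley_walk[OF assms] .
  then show "real (vertex_dist (standard_cayley S T) (u, v) (u', v')) \<le> tree_dist u u' + tree_dist v v'"
    using vertex_dist_le by fastforce
  show "tree_dist u u' + tree_dist v v' \<le> real (vertex_dist (standard_cayley S T) (u, v) (u', v'))"
    using standard_cayley_walk_length[OF relpow_vertex_dist[OF standard_cayley_connected[OF assms]]] .
qed

lemma connected_realization_standard_cayley: "connected_realization (standard_cayley S T)"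
proof (rule connected_realization.intro)
  show "wf_digraph (standard_cayley S T)"
    unfolding standard_cayley_def
    by (intro wf_digraph_cayley_graph group_free_group_product)
      (auto simp: free_group_product_carrier free_group_carrier free_gen_def reduced_Cons)
qed (rule standard_cayley_connected)

theorem strongly_shortcut_standard_cayley: "strongly_shortcut_graph (standard_cayley S T)"
proof -
  interpret connected_realization "standard_cayley S T"
    by (rule connected_realization_standard_cayley)
  show ?thesis
    unfolding strongly_shortcut_graph_def
  proof (rule strongly_shortcut_hexagons)
    fix v :: "nat \<Rightarrow> ('a \<times> bool) list \<times> ('b \<times> bool) list" and r :: real
    assume v: "\<And>i. i < 6 \<Longrightarrow> v i \<in> verts (standard_cayley S T)"
      and side: "\<And>i. i < 6 \<Longrightarrow> real (vertex_dist (standard_cayley S T) (v i) (v (Suc i mod 6))) \<le> r"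
    have dist: "real (vertex_dist (standard_cayley S T) (v i) (v j)) =
        tree_dist (fst (v i)) (fst (v j)) + tree_dist (snd (v i)) (snd (v j))" if "i < 6" "j < 6" for i j
      using vertex_dist_standard_cayley[of "fst (v i)" "snd (v i)" S T "fst (v j)" "snd (v j)"] v that by simp
    obtain j where j: "j < 3" "3 * (tree_dist (fst (v j)) (fst (v (j + 3))) + tree_dist (snd (v j)) (snd (v (j + 3)))) \<le> 7 * r"
    proof -
      have "tree_dist (fst (v i)) (fst (v (Suc i mod 6))) + tree_dist (snd (v i)) (snd (v (Suc i mod 6))) \<le> r"
        if "i < 6" for i
        using that side[of i] dist[of i "Suc i mod 6"] by simp
      then show thesis using that two_tree_hexagon[of "fst \<circ> v" "snd \<circ> v" r] by auto
    qed
    then have "3 * real (vertex_dist (standard_cayley S T) (v j) (v (j + 3))) \<le> 7 * r"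
      using dist[of j "j + 3"] by simp
    with j(1) show "\<exists>j<3. 3 * real (vertex_dist (standard_cayley S T) (v j) (v (j + 3))) \<le> 7 * r"
      by blast
  qed
qed

section \<open>Exponent sums and prefixes\<close>

definition exp_sum :: "'x \<Rightarrow> ('x \<times> bool) list \<Rightarrow> int" where
  "exp_sum x w = (\<Sum>l\<leftarrow>w. if fst l = x then (if snd l then 1 else -1) else 0)"

lemma exp_sum_append [simp]: "exp_sum x (u @ v) = exp_sum x u + exp_sum x v"
  by (simp add: exp_sum_def)

lemma exp_sum_Nil [simp]: "exp_sum x [] = 0"
  by (simp add: exp_sum_def)

lemma exp_sum_Cons [simp]:
  "exp_sum x (l # w) = (if fst l = x then (if snd l then 1 else -1) else 0) + exp_sum x w"
  by (simp add: exp_sum_def)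

lemma exp_sum_replicate [simp]: "exp_sum x (replicate n l) = int n * exp_sum x [l]"
  by (induction n) (auto simp: algebra_simps)

lemma exp_sum_mult_letter:
  assumes "reduced u"
  shows "exp_sum x (foldr reduced_cons u [l]) = exp_sum x u + exp_sum x [l]"
  using assms by (cases rule: mult_letter_cases[of _ l]) (auto simp: inv_letter_def)

text \<open>
  In the Cayley tree, the words with prefix \<open>p @ [k]\<close> are separated from the others by the edge
  between \<open>p\<close> and \<open>p @ [k]\<close>.
\<close>

lemma prefix_mult_letter_change:
  assumes "reduced u" "prefix (p @ [k]) u \<noteq> prefix (p @ [k]) (foldr reduced_cons u [l])"
  shows "fst l = fst k \<and> (u = p \<or> u = p @ [k])"
  using assms(1)
proof (cases rule: mult_letter_cases[of _ l])
  case snoc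
  then show ?thesis using assms(2) by (auto simp: prefix_snoc)
next
  case (cancel w)
  then show ?thesis using assms(2) by (auto simp: prefix_snoc)
qed

text \<open>The separating edge carries the letter \<open>k\<close>, which does not count towards
  the exponent of \<open>x\<close>, so both of its ends have the exponent of \<open>p\<close>. A
  crossing is thus visible in an exponent sum.\<close>

lemma exp_sum_prefix_change:
  assumes "reduced u" "prefix (p @ [k]) u \<noteq> prefix (p @ [k]) (foldr reduced_cons u [l])" "fst k \<noteq> x"
  shows "exp_sum x u = exp_sum x p" "exp_sum x (foldr reduced_cons u [l]) = exp_sum x p"
proof -
  show "exp_sum x u = exp_sum x p"
    using prefix_mult_letter_change[OF assms(1,2)] assms(3) by auto
  then show "exp_sum x (foldr reduced_cons u [l]) = exp_sum x p"
    using prefix_mult_letter_change[OF assms(1,2)] assms(3) by (simp add: exp_sum_mult_letter[OF assms(1)])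
qed

lemma change_point:
  fixes P :: "nat \<Rightarrow> bool"
  shows "P 0 \<noteq> P n \<Longrightarrow> \<exists>i<n. P i \<noteq> P (Suc i)"
  by (induction n) (auto intro: less_SucI)

section \<open>The Cayley graph with a skew generator\<close>

locale skew_cayley =
  fixes a b :: 'x and c d :: 'y
  assumes ab: "a \<noteq> b" and cd: "c \<noteq> d"
begin

abbreviation "G \<equiv> free_group {a, b} \<times>\<times> free_group {c, d}"

text \<open>Since the factors commute, t has the coordinates b^-1 and d; it is the last
  element.\<close>

definition gens :: "(('x \<times> bool) list \<times> ('y \<times> bool) list) set" where
  "gens = {([(a, True)], []), ([(b, True)], []), ([], [(c, True)]), ([(b, False)], [(d, True)])}"

definition H :: "(('x \<times> bool) list \<times> ('y \<times> bool) list,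
    (('x \<times> bool) list \<times> ('y \<times> bool) list) \<times> (('x \<times> bool) list \<times> ('y \<times> bool) list)) pre_digraph" where
  "H = cayley_graph G gens"

lemma verts_iff: "(u, v) \<in> verts H \<longleftrightarrow>
    (fst ` set u \<subseteq> {a, b} \<and> reduced u) \<and> (fst ` set v \<subseteq> {c, d} \<and> reduced v)"
  unfolding H_def by (simp add: cayley_graph_def free_group_product_carrier free_group_carrier)

lemma gens_adjacency:
  assumes "(u, v) \<in> verts H" "(s, t) \<in> gens"
  shows "((u, v), (foldr reduced_cons u s, foldr reduced_cons v t)) \<in> adjacency H"
    "((foldr reduced_cons u s, foldr reduced_cons v t), (u, v)) \<in> adjacency H"
  using adjacency_cayley_graphI[of "(u, v)" G "(s, t)" gens] assms
  by (simp_all only: H_def free_group_product_mult) (simp_all add: cayley_graph_def)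

lemma adjacency_cases:
  assumes "(x, y) \<in> adjacency H"
  obtains (forward) u v s t where "x = (u, v)" "y = (foldr reduced_cons u s, foldr reduced_cons v t)"
      "(u, v) \<in> verts H" "(s, t) \<in> gens"
    | (backward) u v s t where "y = (u, v)" "x = (foldr reduced_cons u s, foldr reduced_cons v t)"
      "(u, v) \<in> verts H" "(s, t) \<in> gens"
proof -
  have V: "verts H = carrier G" by (simp add: H_def cayley_graph_def)
  obtain u v s t where uv: "(u, v) \<in> carrier G" "(s, t) \<in> gens"
      "(x = (u, v) \<and> y = (u, v) \<otimes>\<^bsub>G\<^esub> (s, t)) \<or> (y = (u, v) \<and> x = (u, v) \<otimes>\<^bsub>G\<^esub> (s, t))"
    using assms unfolding H_def adjacency_cayley_graph by (metis surj_pair)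
  then have "(u, v) \<in> verts H" by (simp only: V)
  with uv(2,3) show thesis
    unfolding free_group_product_mult by (elim disjE conjE) (rule forward backward; assumption)+
qed

text \<open>This transfers connectivity from the standard graph. The only standard generator missing
  from \<open>gens\<close> is d = t b, so its edges are replaced by two edges of
  \<open>H\<close>.\<close>

lemma standard_adjacency:
  assumes "(x, y) \<in> adjacency (standard_cayley {a, b} {c, d})"
  shows "(x, y) \<in> (adjacency H)\<^sup>*"
proof -
  have *: "((u, v), (u, v) \<otimes>\<^bsub>G\<^esub> s) \<in> (adjacency H)\<^sup>*"
    if uv: "(u, v) \<in> carrier G" and
      s: "s \<in> (\<lambda>x. (free_gen x, [])) ` {a, b} \<union> (\<lambda>y. ([], free_gen y)) ` {c, d}" for u v s
  proof (cases "s = ([], free_gen d)")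
    case False
    with s have "s = (free_gen a, []) \<or> s = (free_gen b, []) \<or> s = ([], free_gen c)" by blast
    then have "(fst s, snd s) \<in> gens" by (auto simp: gens_def free_gen_def)
    moreover have "(u, v) \<in> verts H" using uv by (simp add: H_def cayley_graph_def)
    ultimately have "((u, v), (foldr reduced_cons u (fst s), foldr reduced_cons v (snd s))) \<in> adjacency H"
      by (rule gens_adjacency(1)[rotated])
    then show ?thesis
      unfolding free_group_product_mult[of "{a, b}" "{c, d}" u v "fst s" "snd s", symmetric] prod.collapse
      by (rule r_into_rtrancl)
  next
    case True
    have V: "(u, v) \<in> verts H" using uv by (simp add: H_def cayley_graph_def)
    then have u: "reduced u" and v: "reduced v" by (auto simp: verts_iff)
    let ?u = "foldr reduced_cons u [(b, False)]" and ?v = "foldr reduced_cons v [(d, True)]"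
    have 1: "((u, v), (?u, ?v)) \<in> adjacency H"
      by (rule gens_adjacency(1)[OF V]) (simp add: gens_def)
    have "(?u, ?v) \<in> verts H"
      using V group.is_monoid[OF group_free_group, THEN monoid.m_closed, of u "{a, b}" "[(b, False)]"]
        group.is_monoid[OF group_free_group, THEN monoid.m_closed, of v "{c, d}" "[(d, True)]"]
      by (simp add: verts_iff free_group_carrier free_group_mult reduced_Cons)
    then have 2: "((?u, ?v), (foldr reduced_cons ?u [(b, True)], foldr reduced_cons ?v [])) \<in> adjacency H"
      by (rule gens_adjacency(1)) (simp add: gens_def)
    have "foldr reduced_cons ?u [(b, True)] = foldr reduced_cons u (foldr reduced_cons [(b, False)] [(b, True)])"
      by (rule foldr_reduced_cons_assoc) (simp add: reduced_Cons)
    also have "\<dots> = u" using u by (simp add: inv_letter_def foldr_reduced_cons_Nil)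
    finally have 3: "foldr reduced_cons ?u [(b, True)] = u" .
    have "foldr reduced_cons ?v [] = ?v"
      by (intro foldr_reduced_cons_Nil reduced_foldr) (simp add: reduced_Cons)
    with 2 3 have "((?u, ?v), (u, ?v)) \<in> adjacency H" by simp
    with 1 have "((u, v), (u, ?v)) \<in> (adjacency H)\<^sup>*"
      by (rule converse_rtrancl_into_rtrancl[OF _ r_into_rtrancl])
    then show ?thesis
      using True u free_group_product_mult[of "{a, b}" "{c, d}" u v "[]" "[(d, True)]"]
      by (simp add: free_gen_def foldr_reduced_cons_Nil)
  qed
  obtain g s where g: "g \<in> carrier G" "s \<in> (\<lambda>x. (free_gen x, [])) ` {a, b} \<union> (\<lambda>y. ([], free_gen y)) ` {c, d}"
      "(x = g \<and> y = g \<otimes>\<^bsub>G\<^esub> s) \<or> (y = g \<and> x = g \<otimes>\<^bsub>G\<^esub> s)"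
    using assms unfolding standard_cayley_def adjacency_cayley_graph by blast
  then have "(g, g \<otimes>\<^bsub>G\<^esub> s) \<in> (adjacency H)\<^sup>*" using *[of "fst g" "snd g" s] by simp
  with g(3) show ?thesis
    by (elim disjE conjE) (simp_all only: symD[OF sym_rtrancl[OF sym_adjacency]])
qed

sublocale connected_realization H
proof (rule connected_realization.intro)
  show "wf_digraph H"
    unfolding H_def
    by (intro wf_digraph_cayley_graph group_free_group_product)
      (auto simp: gens_def free_group_product_carrier free_group_carrier reduced_Cons)
  fix x y assume "x \<in> verts H" "y \<in> verts H"
  then have "(x, y) \<in> (adjacency (standard_cayley {a, b} {c, d}))\<^sup>*"
    by (intro standard_cayley_connected) (simp_all add: H_def standard_cayley_def cayley_graph_def)
  then show "(x, y) \<in> (adjacency H)\<^sup>*"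
  proof induction
    case (step y z)
    then show ?case using rtrancl_trans[OF step.IH standard_adjacency] by blast
  qed simp
qed

section \<open>The plane of drift and height\<close>

definition height :: "('x \<times> bool) list \<times> ('y \<times> bool) list \<Rightarrow> int" where
  "height x = exp_sum d (snd x)"

text \<open>The pair (drift, height) is (1, 0) for b, (0, 1) for t and (0, 0) for a and c. Drift is
  the coordinate that t leaves unchanged, and it equals height exactly where the exponent of b in
  the first factor vanishes.\<close>

definition drift :: "('x \<times> bool) list \<times> ('y \<times> bool) list \<Rightarrow> int" where
  "drift x = exp_sum b (fst x) + exp_sum d (snd x)"

text \<open>The first bound is read off the generators. The root edge labelled a has ends in which b
  has exponent 0, so drift and height agree there; the edge from d^m to d^m c has both ends at
  height \<open>m\<close>.\<close>

lemma gens_step: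
  assumes "(u, v) \<in> verts H" "(s, t) \<in> gens"
  defines "y \<equiv> (foldr reduced_cons u s, foldr reduced_cons v t)"
  shows "\<bar>drift y - drift (u, v)\<bar> + \<bar>height y - height (u, v)\<bar> \<le> 1"
    and "prefix [(a, True)] (fst y) \<noteq> prefix [(a, True)] u \<Longrightarrow>
      drift (u, v) = height (u, v) \<and> drift y = height y"
    and "prefix (replicate m (d, True) @ [(c, True)]) (snd y) \<noteq> prefix (replicate m (d, True) @ [(c, True)]) v \<Longrightarrow>
      height (u, v) = int m \<and> height y = int m"
proof -
  have u: "reduced u" "foldr reduced_cons u [] = u" and v: "reduced v" "foldr reduced_cons v [] = v"
    using assms(1) by (auto simp: verts_iff foldr_reduced_cons_Nil)
  show "\<bar>drift y - drift (u, v)\<bar> + \<bar>height y - height (u, v)\<bar> \<le> 1"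
    using assms(2) ab cd
    by (auto simp: gens_def y_def drift_def height_def exp_sum_mult_letter[OF u(1)] exp_sum_mult_letter[OF v(1)] u v)
  show "drift (u, v) = height (u, v) \<and> drift y = height y"
    if "prefix [(a, True)] (fst y) \<noteq> prefix [(a, True)] u"
  proof -
    obtain l where "s = [] \<or> s = [l]" using assms(2) by (auto simp: gens_def)
    with that u have "s = [l]" by (auto simp: y_def)
    then show ?thesis
      using exp_sum_prefix_change[OF u(1), of "[]" "(a, True)" l b] that ab
      by (simp add: y_def drift_def height_def)
  qed
  show "height (u, v) = int m \<and> height y = int m"
    if "prefix (replicate m (d, True) @ [(c, True)]) (snd y) \<noteq> prefix (replicate m (d, True) @ [(c, True)]) v"
  proof -
    obtain l where "t = [] \<or> t = [l]" using assms(2) by (auto simp: gens_def)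
    with that v have "t = [l]" by (auto simp: y_def)
    then show ?thesis
      using exp_sum_prefix_change[OF v(1), of "replicate m (d, True)" "(c, True)" l d] that cd
      by (simp add: y_def height_def)
  qed
qed

text \<open>\<open>gens_step\<close> gives its equations at both ends of an edge, so they persist
  when the edge is traversed backwards.\<close>

lemma step:
  assumes "(x, y) \<in> adjacency H"
  shows "\<bar>drift y - drift x\<bar> + \<bar>height y - height x\<bar> \<le> 1"
    and "prefix [(a, True)] (fst x) \<noteq> prefix [(a, True)] (fst y) \<Longrightarrow> drift x = height x"
    and "prefix (replicate m (d, True) @ [(c, True)]) (snd x) \<noteq> prefix (replicate m (d, True) @ [(c, True)]) (snd y) \<Longrightarrow>
      height x = int m"
proof -
  have "\<bar>drift y - drift x\<bar> + \<bar>height y - height x\<bar> \<le> 1 \<and>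
    (prefix [(a, True)] (fst x) \<noteq> prefix [(a, True)] (fst y) \<longrightarrow> drift x = height x) \<and>
    (prefix (replicate m (d, True) @ [(c, True)]) (snd x) \<noteq> prefix (replicate m (d, True) @ [(c, True)]) (snd y) \<longrightarrow>
      height x = int m)"
    using assms
  proof (cases rule: adjacency_cases)
    case (forward u v s t)
    show ?thesis
      using gens_step[OF forward(3,4)] unfolding forward(1,2) by (metis fst_conv snd_conv)
  next
    case (backward u v s t)
    show ?thesis
      using gens_step[OF backward(3,4)] unfolding backward(1,2)
      by (metis fst_conv snd_conv abs_minus_commute)
  qed
  then show "\<bar>drift y - drift x\<bar> + \<bar>height y - height x\<bar> \<le> 1"
    and "prefix [(a, True)] (fst x) \<noteq> prefix [(a, True)] (fst y) \<Longrightarrow> drift x = height x"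
    and "prefix (replicate m (d, True) @ [(c, True)]) (snd x) \<noteq> prefix (replicate m (d, True) @ [(c, True)]) (snd y) \<Longrightarrow>
      height x = int m" by blast+
qed

lemma walk_variation:
  assumes "\<And>i. i < n \<Longrightarrow> (g i, g (Suc i)) \<in> adjacency H" "i \<le> j" "j \<le> n"
  shows "\<bar>drift (g j) - drift (g i)\<bar> + \<bar>height (g j) - height (g i)\<bar> \<le> int (j - i)"
  using assms(2,3)
proof (induction j rule: dec_induct)
  case (step j)
  then have "\<bar>drift (g (Suc j)) - drift (g j)\<bar> + \<bar>height (g (Suc j)) - height (g j)\<bar> \<le> 1"
    by (intro skew_cayley.step[OF skew_cayley_axioms] assms(1)) simp
  with step show ?case by (simp add: Suc_diff_le)
qed simp

text \<open>
  A path between the two points must use an edge of the first tree at which drift and height agree,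
  and an edge of the second tree at height \<open>m\<close>. In the plane of drift and height, where every step
  moves by at most 1, this is a round trip from \<open>(0, j)\<close> visiting the diagonal and the line of
  height \<open>m\<close>.
\<close>

lemma vertex_dist_ge:
  assumes "x \<in> verts H" "y \<in> verts H" "drift x = 0" "drift y = 0" "height x = height y"
    "prefix [(a, True)] (fst x) \<noteq> prefix [(a, True)] (fst y)"
    "prefix (replicate m (d, True) @ [(c, True)]) (snd x) \<noteq> prefix (replicate m (d, True) @ [(c, True)]) (snd y)"
  shows "2 * m \<le> vertex_dist H x y"
proof -
  define n where "n = vertex_dist H x y"
  obtain g where g: "g 0 = x" "g n = y" "\<And>i. i < n \<Longrightarrow> (g i, g (Suc i)) \<in> adjacency H"
    using relpow_vertex_dist[OF connected[OF assms(1,2)]] unfolding relpow_fun_conv n_def by blast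
  obtain i where i: "i < n" "drift (g i) = height (g i)"
    using change_point[of "\<lambda>i. prefix [(a, True)] (fst (g i))" n] assms(6) g step(2) by metis
  obtain k where k: "k < n" "height (g k) = int m"
    using change_point[of "\<lambda>i. prefix (replicate m (d, True) @ [(c, True)]) (snd (g i))" n]
      assms(7) g step(3) by metis
  have var: "\<bar>drift (g j) - drift (g i)\<bar> + \<bar>height (g j) - height (g i)\<bar> \<le> int j - int i"
    if "i \<le> j" "j \<le> n" for i j
    using walk_variation[of n g i j] g(3) that by (simp add: of_nat_diff)
  \<comment> \<open>Let \<open>z\<close> be the common value of drift and height at
    \<open>g i\<close>. The drift returns to 0 after visiting \<open>z\<close>, which costs at least
    \<open>2 * \<bar>z\<bar>\<close>; the height returns after visiting \<open>z\<close> and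
    \<open>m\<close>, which costs at least \<open>2 * \<bar>m - z\<bar>\<close>. The sum is at least
    \<open>2 * m\<close>, in whichever order the two visits occur.\<close>
  show ?thesis
  proof (cases "i \<le> k")
    case True
    then show ?thesis
      using var[of 0 i] var[of i k] var[of k n] i k g(1,2) assms(3-5) unfolding n_def[symmetric] by auto
  next
    case False
    then show ?thesis
      using var[of 0 k] var[of k i] var[of i n] i k g(1,2) assms(3-5) unfolding n_def[symmetric] by auto
  qed
qed

section \<open>The commutator loop and its antipodes\<close>

lemma gens_edge:
  assumes "(u, v) \<in> verts H" "(s, t) \<in> gens" "foldr reduced_cons u s = u'" "foldr reduced_cons v t = v'"
  shows "((u, v), (u', v')) \<in> adjacency H" "((u', v'), (u, v)) \<in> adjacency H"
  using gens_adjacency[OF assms(1,2)] assms(3,4) by simp_all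

text \<open>Powers of t act on both coordinates at once, so the loop is written with p b^-i in the
  first factor, for \<open>p\<close> empty or a, and with d^i or the d^m c d^-i of
  \<open>right_word\<close> in the second.\<close>

definition left_word :: "('x \<times> bool) list \<Rightarrow> nat \<Rightarrow> ('x \<times> bool) list" where
  "left_word p i = p @ replicate i (b, False)"

definition right_word :: "nat \<Rightarrow> nat \<Rightarrow> ('y \<times> bool) list" where
  "right_word m i = replicate m (d, True) @ (c, True) # replicate i (d, False)"

lemma reduced_left_word: "p = [] \<or> p = [(a, True)] \<Longrightarrow> reduced (left_word p i)"
  using ab by (cases i) (auto simp: left_word_def reduced_Cons reduced_replicate inv_letter_def)

lemma reduced_right_word: "reduced (right_word m i)"
  using cd by (cases m; cases i)
    (auto simp: right_word_def reduced_append reduced_Cons reduced_replicate inv_letter_def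
      simp del: replicate_Suc simp flip: replicate_append_same dest: sym)

lemma left_word_mult:
  assumes "p = [] \<or> p = [(a, True)]"
  shows "foldr reduced_cons (left_word p i) [(b, False)] = left_word p (Suc i)"
  using mult_letter_snoc[of "left_word p i" "(b, False)"] reduced_left_word[OF assms, of "Suc i"]
  by (simp add: left_word_def replicate_append_same)

lemma right_word_mult: "foldr reduced_cons (right_word m (Suc i)) [(d, True)] = right_word m i"
  using mult_letter_cancel[OF reduced_right_word[of m i], of "(d, True)"]
  by (simp add: right_word_def inv_letter_def replicate_append_same)

lemma replicate_mult: "foldr reduced_cons (replicate i l) [l] = replicate (Suc i) l"
  using mult_letter_snoc[of "replicate i l" l] reduced_replicate[of "Suc i" l]
  by (simp add: replicate_append_same)

lemma verts_left_right:
  assumes "p = [] \<or> p = [(a, True)]"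
  shows "(left_word p i, replicate k (d, True)) \<in> verts H" "(left_word p i, right_word m k) \<in> verts H"
  using assms reduced_left_word[OF assms] reduced_right_word reduced_replicate
  by (auto simp: verts_iff left_word_def right_word_def)

text \<open>
  The vertices on the loop \<open>t\<^sup>m c t\<^sup>-\<^sup>m a t\<^sup>m c\<^sup>-\<^sup>1 t\<^sup>-\<^sup>m a\<^sup>-\<^sup>1\<close>, where \<open>t = d b\<^sup>-\<^sup>1\<close>.
\<close>

definition loop_vertex :: "nat \<Rightarrow> nat \<Rightarrow> ('x \<times> bool) list \<times> ('y \<times> bool) list" where
  "loop_vertex m k =
    (if k \<le> m then (left_word [] k, replicate k (d, True))
     else if k \<le> 2 * m + 1 then (left_word [] (2 * m + 1 - k), right_word m (k - (m + 1)))
     else if k \<le> 3 * m + 2 then (left_word [(a, True)] (k - (2 * m + 2)), right_word m (3 * m + 2 - k))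
     else if k \<le> 4 * m + 3 then (left_word [(a, True)] (4 * m + 3 - k), replicate (4 * m + 3 - k) (d, True))
     else ([], []))"

lemma edge_t_replicate:
  assumes "p = [] \<or> p = [(a, True)]"
  shows "((left_word p i, replicate k (d, True)), (left_word p (Suc i), replicate (Suc k) (d, True))) \<in> adjacency H"
    "((left_word p (Suc i), replicate (Suc k) (d, True)), (left_word p i, replicate k (d, True))) \<in> adjacency H"
  by (rule gens_edge[OF verts_left_right(1)[OF assms] _ left_word_mult[OF assms] replicate_mult], simp add: gens_def)+

lemma edge_t_right_word:
  assumes "p = [] \<or> p = [(a, True)]"
  shows "((left_word p i, right_word m (Suc k)), (left_word p (Suc i), right_word m k)) \<in> adjacency H"
    "((left_word p (Suc i), right_word m k), (left_word p i, right_word m (Suc k))) \<in> adjacency H"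
  by (rule gens_edge[OF verts_left_right(2)[OF assms] _ left_word_mult[OF assms] right_word_mult], simp add: gens_def)+

lemma edge_c:
  assumes "p = [] \<or> p = [(a, True)]"
  shows "((left_word p i, replicate m (d, True)), (left_word p i, right_word m 0)) \<in> adjacency H"
    "((left_word p i, right_word m 0), (left_word p i, replicate m (d, True))) \<in> adjacency H"
proof -
  have "foldr reduced_cons (replicate m (d, True)) [(c, True)] = right_word m 0"
    using mult_letter_snoc[of "replicate m (d, True)" "(c, True)"] reduced_right_word[of m 0]
    by (simp add: right_word_def)
  note gens_edge[OF verts_left_right(1)[OF assms] _ foldr_reduced_cons_Nil[OF reduced_left_word[OF assms]] this]
  then show "((left_word p i, replicate m (d, True)), (left_word p i, right_word m 0)) \<in> adjacency H"
    "((left_word p i, right_word m 0), (left_word p i, replicate m (d, True))) \<in> adjacency H"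
    by (simp_all add: gens_def)
qed

lemma edge_a:
  assumes "([], v) \<in> verts H"
  shows "(([], v), ([(a, True)], v)) \<in> adjacency H" "(([(a, True)], v), ([], v)) \<in> adjacency H"
  by (rule gens_edge[OF assms, of "[(a, True)]" "[]"];
      use assms in \<open>simp add: gens_def verts_iff foldr_reduced_cons_Nil\<close>)+

lemma loop_vertex_adjacency:
  assumes "k < 4 * m + 4"
  shows "(loop_vertex m k, loop_vertex m (Suc k)) \<in> adjacency H"
proof -
  have a: "[(a, True)] = [] \<or> [(a, True)] = [(a, True)]" by simp
  have e: "[] = [] \<or> [] = [(a, True)]" by simp
  \<comment> \<open>The odd cases are the four runs of t or its inverse; the even cases are the
    single letters c, a, c^-1 and a^-1 at the corners.\<close>
  consider (1) "k < m" | (2) "k = m" | (3) i where "i < m" "k = m + 1 + i" | (4) "k = 2 * m + 1"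
    | (5) i where "i < m" "k = 2 * m + 2 + i" | (6) "k = 3 * m + 2"
    | (7) i where "i < m" "k = 3 * m + 3 + i" | (8) "k = 4 * m + 3"
  proof -
    have "k < m \<or> k = m \<or> (m + 1 \<le> k \<and> k - (m + 1) < m) \<or> k = 2 * m + 1 \<or>
        (2 * m + 2 \<le> k \<and> k - (2 * m + 2) < m) \<or> k = 3 * m + 2 \<or>
        (3 * m + 3 \<le> k \<and> k - (3 * m + 3) < m) \<or> k = 4 * m + 3"
      using assms by linarith
    then show thesis using that by (metis le_add_diff_inverse)
  qed
  then show ?thesis
  proof cases
    case 1
    then show ?thesis using edge_t_replicate(1)[OF e, of k k] by (simp add: loop_vertex_def)
  next
    case 2
    then show ?thesis using edge_c(1)[OF e, of m m] by (simp add: loop_vertex_def)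
  next
    case (3 i)
    then have "loop_vertex m k = (left_word [] (Suc (m - Suc i)), right_word m i)"
      "loop_vertex m (Suc k) = (left_word [] (m - Suc i), right_word m (Suc i))"
      by (simp_all add: loop_vertex_def Suc_diff_Suc)
    then show ?thesis using edge_t_right_word(2)[OF e] by simp
  next
    case 4
    then have "loop_vertex m k = ([], right_word m m)" "loop_vertex m (Suc k) = ([(a, True)], right_word m m)"
      by (simp_all add: loop_vertex_def left_word_def)
    then show ?thesis using edge_a(1)[of "right_word m m"] verts_left_right(2)[OF e, of 0 m m]
      by (simp add: left_word_def)
  next
    case (5 i)
    then have "loop_vertex m k = (left_word [(a, True)] i, right_word m (Suc (m - Suc i)))"
      "loop_vertex m (Suc k) = (left_word [(a, True)] (Suc i), right_word m (m - Suc i))"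
      by (simp_all add: loop_vertex_def Suc_diff_Suc)
    then show ?thesis using edge_t_right_word(1)[OF a] by simp
  next
    case 6
    then show ?thesis using edge_c(2)[OF a, of m m] by (simp add: loop_vertex_def)
  next
    case (7 i)
    then have "loop_vertex m k = (left_word [(a, True)] (Suc (m - Suc i)), replicate (Suc (m - Suc i)) (d, True))"
      "loop_vertex m (Suc k) = (left_word [(a, True)] (m - Suc i), replicate (m - Suc i) (d, True))"
      by (simp_all add: loop_vertex_def Suc_diff_Suc del: replicate_Suc)
    then show ?thesis using edge_t_replicate(2)[OF a] by simp
  next
    case 8
    then have "loop_vertex m k = ([(a, True)], [])" "loop_vertex m (Suc k) = ([], [])"
      by (simp_all add: loop_vertex_def left_word_def)
    then show ?thesis using edge_a(2)[of "[]"] by (simp add: verts_iff)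
  qed
qed

lemma height_drift_words:
  "height (left_word p i, replicate k (d, True)) = int k"
  "height (left_word p i, right_word m k) = int m - int k"
  "drift (left_word [] i, replicate k (d, True)) = int k - int i"
  "drift (left_word [(a, True)] i, replicate k (d, True)) = int k - int i"
  "drift (left_word [] i, right_word m k) = int m - int k - int i"
  "drift (left_word [(a, True)] i, right_word m k) = int m - int k - int i"
  using ab cd by (simp_all add: height_def drift_def left_word_def right_word_def)

lemma prefix_words:
  "\<not> prefix [(a, True)] (left_word [] i)" "prefix [(a, True)] (left_word [(a, True)] i)"
  "\<not> prefix (replicate m (d, True) @ [(c, True)]) (replicate k (d, True))"
  "prefix (replicate m (d, True) @ [(c, True)]) (right_word m k)"
proof -
  show "\<not> prefix [(a, True)] (left_word [] i)" by (cases i) (auto simp: left_word_def)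
  show "\<not> prefix (replicate m (d, True) @ [(c, True)]) (replicate k (d, True))"
    using cd set_mono_prefix[of "replicate m (d, True) @ [(c, True)]" "replicate k (d, True)"] by auto
qed (simp_all add: left_word_def right_word_def)

text \<open>The whole loop has drift 0. A half turn preserves the height but exchanges the two sides
  both of the a-edge in the first tree and of the c-edge in the second, which is the situation of
  \<open>vertex_dist_ge\<close>.\<close>

lemma loop_vertex_antipodal:
  assumes "k < 2 * m + 2"
  shows "2 * m \<le> vertex_dist H (loop_vertex m k) (loop_vertex m (k + (2 * m + 2)))"
proof -
  have a: "[(a, True)] = [] \<or> [(a, True)] = [(a, True)]" by simp
  have e: "[] = [] \<or> [] = [(a, True)]" by simp
  show ?thesis
  proof (cases "k \<le> m")
    case True
    then have "loop_vertex m k = (left_word [] k, replicate k (d, True))"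
      "loop_vertex m (k + (2 * m + 2)) = (left_word [(a, True)] k, right_word m (m - k))"
      by (simp_all add: loop_vertex_def)
    then show ?thesis
      using True verts_left_right[OF e] verts_left_right[OF a]
      by (intro vertex_dist_ge) (simp_all add: height_drift_words prefix_words of_nat_diff)
  next
    case False
    define i where "i = k - (m + 1)"
    have i: "k = m + 1 + i" "i \<le> m" using False assms by (simp_all add: i_def)
    then have "loop_vertex m k = (left_word [] (m - i), right_word m i)"
      "loop_vertex m (k + (2 * m + 2)) = (left_word [(a, True)] (m - i), replicate (m - i) (d, True))"
      by (simp_all add: loop_vertex_def)
    then show ?thesis
      using i verts_left_right[OF e] verts_left_right[OF a]
      by (intro vertex_dist_ge) (simp_all add: height_drift_words prefix_words of_nat_diff)
  qed
qed

theorem not_strongly_shortcut: "\<not> strongly_shortcut_graph H"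
  unfolding strongly_shortcut_graph_def
\<comment> \<open>The half-length \<open>2 * n + 2\<close> exceeds the guaranteed antipodal distance
  \<open>2 * n\<close> by 2, whatever \<open>n\<close> is.\<close>
proof (rule not_strongly_shortcut_antipodal[where c = 2])
  fix n
  show "\<exists>h g. n \<le> h \<and> g 0 \<in> verts H \<and> g (2 * h) = g 0 \<and>
      (\<forall>k<2 * h. (g k, g (Suc k)) \<in> adjacency H) \<and> (\<forall>k<h. h \<le> vertex_dist H (g k) (g (k + h)) + 2)"
  proof (intro exI[of _ "2 * n + 2"] exI[of _ "loop_vertex n"] conjI allI impI)
    show "loop_vertex n 0 \<in> verts H" by (simp add: loop_vertex_def left_word_def verts_iff)
    show "loop_vertex n (2 * (2 * n + 2)) = loop_vertex n 0" by (simp add: loop_vertex_def left_word_def)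
    show "(loop_vertex n k, loop_vertex n (Suc k)) \<in> adjacency H" if "k < 2 * (2 * n + 2)" for k
      using loop_vertex_adjacency[of k n] that by simp
    show "2 * n + 2 \<le> vertex_dist H (loop_vertex n k) (loop_vertex n (k + (2 * n + 2))) + 2" if "k < 2 * n + 2" for k
      using loop_vertex_antipodal[OF that] by simp
  qed simp
qed

end

theorem theorem1p1:
  fixes a b :: 'x and c d :: 'y
  assumes "a \<noteq> b" and "c \<noteq> d"
  shows "let F = free_group {a, b}; F' = free_group {c, d}; G = F \<times>\<times> F';
             ga = (free_gen a, \<one>\<^bsub>F'\<^esub>); gb = (free_gen b, \<one>\<^bsub>F'\<^esub>);
             gc = (\<one>\<^bsub>F\<^esub>, free_gen c); gd = (\<one>\<^bsub>F\<^esub>, free_gen d)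
         in strongly_shortcut_graph (cayley_graph G {ga, gb, gc, gd}) \<and>
            \<not> strongly_shortcut_graph (cayley_graph G {ga, gb, gc, gd \<otimes>\<^bsub>G\<^esub> inv\<^bsub>G\<^esub> gb})"
proof -
  interpret skew_cayley a b c d by (rule skew_cayley.intro[OF assms])
  let ?F = "free_group {a, b}" and ?F' = "free_group {c, d}"
  have "inv\<^bsub>?F \<times>\<times> ?F'\<^esub> (free_gen b, []) = ([(b, False)], [])"
  proof (rule group.inv_equality[OF group_free_group_product])
    show "([(b, False)], []) \<otimes>\<^bsub>?F \<times>\<times> ?F'\<^esub> (free_gen b, []) = \<one>\<^bsub>?F \<times>\<times> ?F'\<^esub>"
      by (simp add: free_group_product_mult free_group_mult free_gen_def inv_letter_def DirProd_def free_group_one)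
  qed (simp_all add: free_group_product_carrier free_group_carrier free_gen_def reduced_Cons)
  then have "([], free_gen d) \<otimes>\<^bsub>?F \<times>\<times> ?F'\<^esub> inv\<^bsub>?F \<times>\<times> ?F'\<^esub> (free_gen b, []) = ([(b, False)], [(d, True)])"
    by (simp add: free_group_product_mult free_group_mult free_gen_def)
  then have "\<not> strongly_shortcut_graph (cayley_graph (?F \<times>\<times> ?F')
      {(free_gen a, []), (free_gen b, []), ([], free_gen c),
       ([], free_gen d) \<otimes>\<^bsub>?F \<times>\<times> ?F'\<^esub> inv\<^bsub>?F \<times>\<times> ?F'\<^esub> (free_gen b, [])})"
    using not_strongly_shortcut by (simp add: H_def gens_def free_gen_def)
  moreover have "(\<lambda>x. (free_gen x, [])) ` {a, b} \<union> (\<lambda>y. ([], free_gen y)) ` {c, d} =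
      {(free_gen a, []), (free_gen b, []), ([], free_gen c), ([], free_gen d)}" by auto
  then have "strongly_shortcut_graph (cayley_graph (?F \<times>\<times> ?F')
      {(free_gen a, []), (free_gen b, []), ([], free_gen c), ([], free_gen d)})"
    using strongly_shortcut_standard_cayley[of "{a, b}" "{c, d}"] by (simp add: standard_cayley_def)
  ultimately show ?thesis by (simp only: Let_def free_group_one simp_thms)
qed

end
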